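(* Every countable graph $G$ that contains no alternating ray admits an unfriendly partition, i.e. there is a map $c:V(G)\to\{0,1\}$ such that for every vertex $v\in V(G)$, $$|\{u\in N(v): c(u)\neq c(v)\}|\ \ge\ |\{u\in N(v): c(u)=c(v)\}|$$ (as cardinals).
   Context: Graphs are simple and undirected, possibly infinite; $N(v)$ denotes the neighborhood of $v$ and the degree of $v$ is the cardinality $|N(v)|$. A ray is a one-way infinite path $v_0v_1v_2\dots$ (distinct vertices, consecutive ones adjacent); it passes through the vertices $v_n$, $n\in\mathbb{N}$. A ray is alternating if it passes through infinitely many vertices of finite degree and through infinitely many vertices of infinite degree. *)

theory Defs
  imports Main "HOL-Library.Countable_Set" "HOL-Library.Equipollence"
begin

definition simple_graph :: "'a set \<Rightarrow> ('a \<Rightarrow> 'a \<Rightarrow> bool) \<Rightarrow> bool" where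
  "simple_graph V E \<longleftrightarrow>
     (\<forall>u v. E u v \<longrightarrow> E v u) \<and> (\<forall>v. \<not> E v v) \<and> (\<forall>u v. E u v \<longrightarrow> u \<in> V \<and> v \<in> V)"

definition nbhd :: "'a set \<Rightarrow> ('a \<Rightarrow> 'a \<Rightarrow> bool) \<Rightarrow> 'a \<Rightarrow> 'a set" where
  "nbhd V E v = {u \<in> V. E v u}"

definition is_ray :: "'a set \<Rightarrow> ('a \<Rightarrow> 'a \<Rightarrow> bool) \<Rightarrow> (nat \<Rightarrow> 'a) \<Rightarrow> bool" where
  "is_ray V E r \<longleftrightarrow> inj r \<and> (\<forall>n. r n \<in> V) \<and> (\<forall>n. E (r n) (r (Suc n)))"

text \<open>Alternating: passes through infinitely many vertices of finite degree and
  infinitely many of infinite degree (the ray is injective, so counting indices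
  is the same as counting vertices).\<close>
definition alternating_ray :: "'a set \<Rightarrow> ('a \<Rightarrow> 'a \<Rightarrow> bool) \<Rightarrow> (nat \<Rightarrow> 'a) \<Rightarrow> bool" where
  "alternating_ray V E r \<longleftrightarrow> is_ray V E r
     \<and> infinite {n. finite (nbhd V E (r n))}
     \<and> infinite {n. infinite (nbhd V E (r n))}"

definition unfriendly_partition :: "'a set \<Rightarrow> ('a \<Rightarrow> 'a \<Rightarrow> bool) \<Rightarrow> ('a \<Rightarrow> bool) \<Rightarrow> bool" where
  "unfriendly_partition V E c \<longleftrightarrow>
     (\<forall>v\<in>V. {u \<in> nbhd V E v. c u = c v} \<lesssim> {u \<in> nbhd V E v. c u \<noteq> c v})"

end

theory Submission
  imports Defs
begin

text \<open>
  Let \<open>F\<close> and \<open>I\<close> be the sets of vertices of finite and of infinite degree. A colouring is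
  called stable on \<open>X \<subseteq> F\<close> if no recolouring of finitely many vertices of \<open>X\<close> increases the
  number of cut edges; stable vertices are happy. If a vertex \<open>y \<in> I\<close> has only finitely many
  neighbours of the opposite colour, then after switching \<open>y\<close> the possible gain is bounded, so
  finitely many further changes in \<open>F\<close> restore stability, and no other vertex of \<open>I\<close> notices.

  Let \<open>K\<close> be the largest subset of \<open>I\<close> inducing a subgraph of infinite minimum degree;
  it is coloured first and kept. The vertices of \<open>W = I - K\<close> are ranked such that all but finitely
  many \<open>I\<close>-neighbours of \<open>y \<in> W\<close> in \<open>W \<union> K\<close> have lower rank. Each \<open>y \<in> W\<close> with finitely many
  neighbours in \<open>F\<close> gets an infinite set \<open>R y\<close> of neighbours of lower rank, with the sets \<open>R y\<close>
  disjoint. Of the edges inside \<open>W\<close> only those from \<open>y\<close> to \<open>R y\<close> are kept. In the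
  resulting graph \<open>H\<close> on \<open>F \<union> W\<close> vertices of \<open>W\<close> still have infinite degree, and a ray that
  meets \<open>W\<close> infinitely often would be alternating. Hence, in the order of a normal spanning
  tree of \<open>H\<close>, there is no infinite ascending chain in \<open>W\<close>, and the part of the graph
  above \<open>y \<in> W\<close> can be coloured by well-founded recursion: glue colourings of the parts above the next
  vertices of \<open>W\<close>, and then switch \<open>y\<close> if necessary.
\<close>

subsection \<open>Stable colourings\<close>

lemma bounded_int_attains_max:
  fixes f :: "'b \<Rightarrow> int"
  assumes "P x0" and "\<And>x. P x \<Longrightarrow> f x \<le> b"
  shows "\<exists>x. P x \<and> (\<forall>y. P y \<longrightarrow> f y \<le> f x)"
proof -
  obtain x where x: "P x" "\<And>y. P y \<Longrightarrow> nat (b - f x) \<le> nat (b - f y)"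
    using ex_has_least_nat[of P x0 "\<lambda>x. nat (b - f x)"] assms(1) by blast
  have "f y \<le> f x" if "P y" for y
    using x(2)[OF that] assms(2)[OF that] assms(2)[OF x(1)] by linarith
  with x(1) show ?thesis by blast
qed

text \<open>Compactness by a diagonal argument: decreasing infinite index sets \<open>N k\<close>
  are chosen such that on \<open>N (Suc k)\<close> the colour of the \<open>k\<close>-th vertex is
  constant. A finite \<open>A\<close> is settled after finitely many stages.\<close>

lemma limit_colouring:
  fixes cs :: "nat \<Rightarrow> 'a \<Rightarrow> bool"
  assumes "countable X"
  shows "\<exists>c. \<forall>A. finite A \<and> A \<subseteq> X \<longrightarrow> infinite {n. \<forall>v\<in>A. cs n v = c v}"
proof -
  let ?e = "from_nat_into X"
  have "\<exists>N. \<forall>k. infinite (N k) \<and> (N (Suc k) \<subseteq> N k \<and> (\<exists>b. \<forall>n\<in>N (Suc k). cs n (?e k) = b))"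
  proof (rule dependent_nat_choice)
    show "\<exists>M::nat set. infinite M" by (rule exI[of _ UNIV]) simp
  next
    fix M :: "nat set" and k
    assume inf: "infinite M"
    have M: "M = {n\<in>M. cs n (?e k) = True} \<union> {n\<in>M. cs n (?e k) = False}" by auto
    have "infinite {n\<in>M. cs n (?e k) = True} \<or> infinite {n\<in>M. cs n (?e k) = False}"
      using inf M by (metis finite_UnI)
    then obtain b where b: "infinite {n\<in>M. cs n (?e k) = b}" by blast
    show "\<exists>N. infinite N \<and> (N \<subseteq> M \<and> (\<exists>b. \<forall>n\<in>N. cs n (?e k) = b))"
      by (rule exI[of _ "{n\<in>M. cs n (?e k) = b}"]) (use b in auto)
  qed
  then obtain N where N: "\<And>k. infinite (N k)" "\<And>k. N (Suc k) \<subseteq> N k"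
    "\<And>k. \<exists>b. \<forall>n\<in>N (Suc k). cs n (?e k) = b" by blast
  have anti: "N j \<subseteq> N i" if "i \<le> j" for i j
    using that N(2) by (rule lift_Suc_antimono_le[rotated])
  define c where "c v = (\<forall>n\<in>N (Suc (to_nat_on X v)). cs n v)" for v
  have c: "cs n v = c v" if "v \<in> X" "n \<in> N (Suc (to_nat_on X v))" for n v
  proof -
    have "?e (to_nat_on X v) = v" using that(1) assms by simp
    then show ?thesis using N(3)[of "to_nat_on X v"] that(2) unfolding c_def by auto
  qed
  have "infinite {n. \<forall>v\<in>A. cs n v = c v}" if A: "finite A" "A \<subseteq> X" for A
  proof -
    define m where "m = Suc (Max (insert 0 (to_nat_on X ` A)))"
    have "Suc (to_nat_on X v) \<le> m" if "v \<in> A" for v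
      unfolding m_def using A(1) that by simp
    then have "N m \<subseteq> {n. \<forall>v\<in>A. cs n v = c v}" using anti c A(2) by blast
    then show ?thesis using N(1) infinite_super by blast
  qed
  then show ?thesis by blast
qed

section \<open>Cuts, and stability under finite recolourings\<close>

locale cut_graph =
  fixes E :: "'a \<Rightarrow> 'a \<Rightarrow> bool" and F :: "'a set"
  assumes sym: "E u v \<Longrightarrow> E v u"
    and irrefl: "\<not> E v v"
    and finite_degree: "v \<in> F \<Longrightarrow> finite {u. E v u}"
begin

text \<open>Edges are doubletons, so that an edge with both ends in \<open>S\<close> is counted
  once.\<close>

definition edges_at :: "'a set \<Rightarrow> 'a set set" where
  "edges_at S = {{u, v} | u v. u \<in> S \<and> E u v}"

definition is_cut :: "('a \<Rightarrow> bool) \<Rightarrow> 'a set \<Rightarrow> bool" where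
  "is_cut c e \<longleftrightarrow> (\<exists>u\<in>e. \<exists>v\<in>e. c u \<noteq> c v)"

definition cut_size :: "'a set \<Rightarrow> ('a \<Rightarrow> bool) \<Rightarrow> int" where
  "cut_size S c = (\<Sum>e\<in>edges_at S. of_bool (is_cut c e))"

text \<open>Cut edges are counted only at \<open>S\<close>: their total number may be infinite,
  while recolouring \<open>S\<close> affects no other edge.\<close>

definition stable :: "'a set \<Rightarrow> ('a \<Rightarrow> bool) \<Rightarrow> bool" where
  "stable X c \<longleftrightarrow> (\<forall>S d. finite S \<and> S \<subseteq> X \<and> (\<forall>v. v \<notin> S \<longrightarrow> d v = c v) \<longrightarrow>
     cut_size S d \<le> cut_size S c)"

lemma is_cut_pair [simp]: "is_cut c {u, v} \<longleftrightarrow> c u \<noteq> c v"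
  by (auto simp: is_cut_def)

lemma finite_edges_at:
  assumes "finite S" "S \<subseteq> F"
  shows "finite (edges_at S)"
proof -
  have "edges_at S = (\<Union>u\<in>S. (\<lambda>v. {u, v}) ` {v. E u v})" by (auto simp: edges_at_def)
  then show ?thesis using assms finite_degree by auto
qed

lemma edges_at_mono: "S \<subseteq> T \<Longrightarrow> edges_at S \<subseteq> edges_at T"
  by (auto simp: edges_at_def)

lemma edge_atI: "E u v \<Longrightarrow> u \<in> S \<or> v \<in> S \<Longrightarrow> {u, v} \<in> edges_at S"
  unfolding edges_at_def using sym by (blast intro: insert_commute)

lemma cut_size_le:
  assumes "finite S" "S \<subseteq> F"
  shows "cut_size S c \<le> int (card (edges_at S))"
  unfolding cut_size_def using sum_bounded_above[of "edges_at S" "\<lambda>e. of_bool (is_cut c e) :: int" 1]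
  by simp

lemma cut_size_cong:
  assumes "\<And>v. v \<in> S \<Longrightarrow> c v = d v" "\<And>u v. u \<in> S \<Longrightarrow> E u v \<Longrightarrow> c v = d v"
  shows "cut_size S c = cut_size S d"
  unfolding cut_size_def
proof (rule sum.cong[OF refl])
  fix e assume "e \<in> edges_at S"
  then obtain u v where "e = {u, v}" "u \<in> S" "E u v" by (auto simp: edges_at_def)
  then show "of_bool (is_cut c e) = (of_bool (is_cut d e) :: int)"
    using assms(1)[of u] assms(2)[of u v] by simp
qed

text \<open>An edge that misses \<open>S\<close> has the same status under both colourings, so a
  gain may be computed on any finite subset of \<open>F\<close> containing the changed
  vertices.\<close>

lemma cut_size_diff_mono:
  assumes "finite T" "T \<subseteq> F" "S \<subseteq> T" and "\<And>v. v \<notin> S \<Longrightarrow> c v = d v"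
  shows "cut_size T c - cut_size T d = cut_size S c - cut_size S d"
proof -
  let ?f = "\<lambda>e. of_bool (is_cut c e) - (of_bool (is_cut d e) :: int)"
  have "sum ?f (edges_at S) = sum ?f (edges_at T)"
  proof (rule sum.mono_neutral_left)
    show "finite (edges_at T)" using assms finite_edges_at by blast
    show "edges_at S \<subseteq> edges_at T" using assms edges_at_mono by blast
    show "\<forall>e\<in>edges_at T - edges_at S. ?f e = 0"
    proof
      fix e assume e: "e \<in> edges_at T - edges_at S"
      then obtain u v where uv: "e = {u, v}" "E u v" by (auto simp: edges_at_def)
      then have "u \<notin> S" "v \<notin> S" using e edge_atI by blast+
      then show "?f e = 0" using uv assms(4) by simp
    qed
  qed
  then show ?thesis by (simp add: cut_size_def sum_subtractf)
qed

text \<open>A flexible form of stability: the set \<open>T\<close> on which cut edges are counted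
  may exceed the set of changed vertices and may leave \<open>X\<close>.\<close>

lemma stable_le:
  assumes "stable X c" "X \<subseteq> F" "finite T" "T \<subseteq> F" "{v. d v \<noteq> c v} \<subseteq> T \<inter> X"
  shows "cut_size T d \<le> cut_size T c"
proof -
  have off: "d v = c v" if "v \<notin> T \<inter> X" for v using assms(5) that by blast
  have "cut_size (T \<inter> X) d \<le> cut_size (T \<inter> X) c"
    using assms(1,3) off unfolding stable_def by simp
  then show ?thesis using cut_size_diff_mono[of T "T \<inter> X" d c] assms off by simp
qed

lemma stable_cong:
  assumes "stable X c" and "\<And>v. v \<in> X \<Longrightarrow> c v = d v" "\<And>u v. u \<in> X \<Longrightarrow> E u v \<Longrightarrow> c v = d v"
  shows "stable X d"
  unfolding stable_def
proof (intro allI impI)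
  fix S d' assume S: "finite S \<and> S \<subseteq> X \<and> (\<forall>v. v \<notin> S \<longrightarrow> d' v = d v)"
  define c' where "c' v = (if v \<in> S then d' v else c v)" for v
  have "cut_size S c' \<le> cut_size S c"
    using assms(1) S unfolding stable_def c'_def by simp
  moreover have "cut_size S c = cut_size S d"
    using S assms by (intro cut_size_cong) auto
  moreover have "cut_size S c' = cut_size S d'"
    using S assms unfolding c'_def by (intro cut_size_cong) auto
  ultimately show "cut_size S d' \<le> cut_size S d" by simp
qed

text \<open>The changes are made in two rounds, first on \<open>X\<close>, giving \<open>d1\<close>,
  then on \<open>Y\<close>. As no edge joins the two sets, the first round is invisible from
  \<open>Y\<close>, and \<open>d1\<close> is still stable there.\<close>

lemma stable_Un:
  assumes "stable X c" "stable Y c" "X \<subseteq> F" "Y \<subseteq> F" "X \<inter> Y = {}"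
    and "\<And>u v. u \<in> X \<Longrightarrow> v \<in> Y \<Longrightarrow> \<not> E u v"
  shows "stable (X \<union> Y) c"
  unfolding stable_def
proof (intro allI impI)
  fix S d assume S: "finite S \<and> S \<subseteq> X \<union> Y \<and> (\<forall>v. v \<notin> S \<longrightarrow> d v = c v)"
  define d1 where "d1 v = (if v \<in> Y then c v else d v)" for v
  have SF: "finite S" "S \<subseteq> F" using S assms by auto
  have "stable Y d1"
  proof (rule stable_cong[OF assms(2)])
    show "c v = d1 v" if "u \<in> Y" "E u v" for u v
      using that S assms(6)[of v u] sym unfolding d1_def by auto
  qed (simp add: d1_def)
  then have "cut_size S d \<le> cut_size S d1"
    by (rule stable_le) (use S SF assms in \<open>auto simp: d1_def\<close>)
  also have "\<dots> \<le> cut_size S c"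
    using assms(1) by (rule stable_le) (use S SF assms in \<open>auto simp: d1_def\<close>)
  finally show "cut_size S d \<le> cut_size S c" .
qed

lemma stable_UN:
  assumes "finite J" "\<And>i. i \<in> J \<Longrightarrow> stable (X i) c" "\<And>i. i \<in> J \<Longrightarrow> X i \<subseteq> F"
    and "\<And>i j. i \<in> J \<Longrightarrow> j \<in> J \<Longrightarrow> i \<noteq> j \<Longrightarrow> X i \<inter> X j = {}"
    and "\<And>i j u v. i \<in> J \<Longrightarrow> j \<in> J \<Longrightarrow> i \<noteq> j \<Longrightarrow> u \<in> X i \<Longrightarrow> v \<in> X j \<Longrightarrow> \<not> E u v"
  shows "stable (\<Union>i\<in>J. X i) c"
  using assms
proof (induction J rule: finite_induct)
  case empty
  have "d = c" if "\<forall>v. v \<notin> {} \<longrightarrow> d v = c v" for d using that by auto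
  then show ?case unfolding stable_def by auto
next
  case (insert j J)
  have "stable (X j \<union> (\<Union>i\<in>J. X i)) c"
  proof (rule stable_Un)
    show "stable (\<Union>i\<in>J. X i) c" 
    proof (rule insert.IH)
      show "\<not> E u v" if "i \<in> J" "k \<in> J" "i \<noteq> k" "u \<in> X i" "v \<in> X k" for i k u v
        using that by (intro insert.prems(4)[of i k]) auto
    qed (simp_all add: insert.prems(1-3))
    show "X j \<inter> (\<Union>i\<in>J. X i) = {}" using insert.hyps(2) insert.prems(3)[of j] by auto
    show "\<not> E u v" if "u \<in> X j" "v \<in> (\<Union>i\<in>J. X i)" for u v
      using that insert.hyps(2) insert.prems(4)[of j] by auto
  qed (use insert.prems in auto)
  then show ?case by simp
qed

lemma cut_size_singleton:
  assumes "v \<in> F"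
  shows "cut_size {v} c = int (card {u. E v u \<and> c u \<noteq> c v})"
proof -
  have "{e \<in> edges_at {v}. is_cut c e} = (\<lambda>u. {v, u}) ` {u. E v u \<and> c u \<noteq> c v}"
    by (auto simp: edges_at_def)
  moreover have "inj_on (\<lambda>u. {v, u}) {u. E v u \<and> c u \<noteq> c v}"
    by (auto simp: inj_on_def doubleton_eq_iff)
  moreover have "cut_size {v} c = int (card {e \<in> edges_at {v}. is_cut c e})"
    unfolding cut_size_def using finite_edges_at[of "{v}"] assms
    by (simp add: of_bool_def sum.If_cases Int_def)
  ultimately show ?thesis by (simp add: card_image)
qed

lemma stable_friendly_le:
  assumes "stable X c" "v \<in> X" "X \<subseteq> F"
  shows "card {u. E v u \<and> c u = c v} \<le> card {u. E v u \<and> c u \<noteq> c v}"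
proof -
  define d where "d = c(v := \<not> c v)"
  have v: "v \<in> F" using assms by blast
  have "cut_size {v} d \<le> cut_size {v} c"
    using assms(1,2) unfolding stable_def d_def by simp
  then have "card {u. E v u \<and> d u \<noteq> d v} \<le> card {u. E v u \<and> c u \<noteq> c v}"
    using cut_size_singleton[OF v] by simp
  moreover have "{u. E v u \<and> d u \<noteq> d v} = {u. E v u \<and> c u = c v}"
    using irrefl by (auto simp: d_def)
  ultimately show ?thesis by simp
qed

section \<open>Existence, finite repair and gluing of stable colourings\<close>

lemma exists_stable:
  assumes "countable X" "X \<subseteq> F"
  shows "\<exists>c. (\<forall>v. v \<notin> X \<longrightarrow> c v = g v) \<and> stable X c"
proof -
  \<comment> \<open>Finite initial segments of \<open>X\<close>; on each of them an optimal
    colouring \<open>cs n\<close> extending \<open>g\<close> exists, and \<open>c\<close> is a limit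
    of these.\<close>
  define S where "S n = {v \<in> X. to_nat_on X v < n}" for n
  have S: "finite (S n)" "S n \<subseteq> X" "S n \<subseteq> F" for n
  proof -
    have "inj_on (to_nat_on X) (S n)"
      using inj_on_to_nat_on[OF assms(1)] by (rule inj_on_subset) (auto simp: S_def)
    moreover have "to_nat_on X ` S n \<subseteq> {..<n}" by (auto simp: S_def)
    ultimately show "finite (S n)" by (meson finite_imageD finite_lessThan finite_subset)
  qed (use assms in \<open>auto simp: S_def\<close>)
  have "\<exists>c. (\<forall>v. v \<notin> S n \<longrightarrow> c v = g v) \<and>
      (\<forall>d. (\<forall>v. v \<notin> S n \<longrightarrow> d v = g v) \<longrightarrow> cut_size (S n) d \<le> cut_size (S n) c)" for n
    by (rule bounded_int_attains_max[of _ g _ "int (card (edges_at (S n)))"]) (use cut_size_le S in auto)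
  then obtain cs where cs: "\<And>n v. v \<notin> S n \<Longrightarrow> cs n v = g v"
    "\<And>n d. (\<And>v. v \<notin> S n \<Longrightarrow> d v = g v) \<Longrightarrow> cut_size (S n) d \<le> cut_size (S n) (cs n)"
    by metis
  obtain c0 where c0: "\<And>A. finite A \<Longrightarrow> A \<subseteq> X \<Longrightarrow> infinite {n. \<forall>v\<in>A. cs n v = c0 v}"
    using limit_colouring[OF assms(1), of cs] by blast
  define c where "c v = (if v \<in> X then c0 v else g v)" for v
  have "stable X c"
    unfolding stable_def
  proof (intro allI impI)
    fix T d assume T: "finite T \<and> T \<subseteq> X \<and> (\<forall>v. v \<notin> T \<longrightarrow> d v = c v)"
    \<comment> \<open>The vertices of \<open>X\<close> whose colours enter
      \<open>cut_size T\<close>. There are finitely many, so infinitely many \<open>cs n\<close>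
      agree with \<open>c\<close> on them, and one with \<open>T\<close> inside \<open>S n\<close>
      can be chosen.\<close>
    define A where "A = (T \<union> (\<Union>u\<in>T. {v. E u v})) \<inter> X"
    have "finite {v. E u v}" if "u \<in> T" for u
      using finite_degree that T assms(2) by (meson subsetD)
    then have "finite (\<Union>u\<in>T. {v. E u v})" using T by simp
    then have "finite A" unfolding A_def using T by auto
    then have "infinite {n. \<forall>v\<in>A. cs n v = c0 v}" by (rule c0) (simp add: A_def)
    then obtain n where n: "Suc (Max (insert 0 (to_nat_on X ` T))) \<le> n" "\<forall>v\<in>A. cs n v = c0 v"
      unfolding infinite_nat_iff_unbounded_le by blast
    have TS: "T \<subseteq> S n"
    proof
      fix v assume v: "v \<in> T"
      then have "to_nat_on X v \<le> Max (insert 0 (to_nat_on X ` T))" using T by simp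
      then have "to_nat_on X v < n" using n(1) by linarith
      moreover have "v \<in> X" using T v by blast
      ultimately show "v \<in> S n" by (simp add: S_def)
    qed
    define d' where "d' v = (if v \<in> T then d v else cs n v)" for v
    have "cut_size (S n) d' \<le> cut_size (S n) (cs n)"
      by (rule cs(2)) (use TS cs(1) in \<open>auto simp: d'_def\<close>)
    then have le: "cut_size T d' \<le> cut_size T (cs n)"
      using cut_size_diff_mono[of "S n" T d' "cs n"] S TS by (simp add: d'_def)
    have eq: "cs n v = c v" if "v \<in> T \<or> (\<exists>u\<in>T. E u v)" for v
      using that n(2) cs(1)[of v n] S(2)[of n] unfolding A_def c_def by auto
    have "cut_size T (cs n) = cut_size T c"
      by (rule cut_size_cong; rule eq; blast)
    moreover have "cut_size T d' = cut_size T d"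
    proof (rule cut_size_cong)
      show "d' v = d v" if "u \<in> T" "E u v" for u v
        using eq[of v] that T by (auto simp: d'_def)
    qed (simp add: d'_def)
    ultimately show "cut_size T d \<le> cut_size T c" using le by simp
  qed
  moreover have "\<forall>v. v \<notin> X \<longrightarrow> c v = g v" by (simp add: c_def)
  ultimately show ?thesis by blast
qed

text \<open>Recolouring the outside so that only finitely many cut edges into \<open>X\<close> become uncut bounds
  the gain of every finite recolouring inside \<open>X\<close>; hence finitely many changes in \<open>X\<close>
  restore stability. The recoloured outside vertices may have infinite degree.\<close>
lemma finite_repair:
  assumes "stable X c" "X \<subseteq> F" and same: "\<And>v. v \<in> X \<Longrightarrow> c' v = c v"
    and fin: "finite {(u, v). u \<in> X \<and> v \<notin> X \<and> E u v \<and> c' v \<noteq> c v \<and> c u \<noteq> c v}"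
  shows "\<exists>d. finite {v. d v \<noteq> c' v} \<and> {v. d v \<noteq> c' v} \<subseteq> X \<and> stable X d"
proof -
  define Q where "Q = (\<lambda>(u, v). {u, v}) ` {(u, v). u \<in> X \<and> v \<notin> X \<and> E u v \<and> c' v \<noteq> c v \<and> c u \<noteq> c v}"
  have finQ: "finite Q" unfolding Q_def using fin by simp
  have bound: "cut_size S d - cut_size S c' \<le> 2 * int (card Q)"
    if S: "finite S" "S \<subseteq> X" and d: "\<And>v. v \<notin> S \<Longrightarrow> d v = c' v" for S d
  proof -
    \<comment> \<open>The same recolouring of \<open>S\<close> applied to \<open>c\<close> instead
      of \<open>c'\<close>; its gain is at most 0 by stability of \<open>c\<close>.\<close>
    define d0 where "d0 v = (if v \<in> S then d v else c v)" for v
    have finS: "finite (edges_at S)" using S assms finite_edges_at by blast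
    \<comment> \<open>An edge from \<open>X\<close> to a recoloured outside vertex that is not in
      \<open>Q\<close> is uncut under \<open>c\<close> and cut under \<open>c'\<close>: the left
      side is at most 0, the right side at least 0. For an edge in \<open>Q\<close> the summand 2
      suffices.\<close>
    have edge: "of_bool (is_cut d e) - of_bool (is_cut c' e)
        \<le> of_bool (is_cut d0 e) - of_bool (is_cut c e) + (2 * of_bool (e \<in> Q) :: int)"
      if e: "e \<in> edges_at S" for e
    proof -
      obtain u v where uv: "e = {u, v}" "u \<in> S" "E u v" using e by (auto simp: edges_at_def)
      have u: "u \<in> X" "c' u = c u" "d0 u = d u" using uv S same by (auto simp: d0_def)
      show ?thesis
      proof (cases "v \<in> X \<or> c' v = c v")
        case True
        then have "c' v = c v" "d0 v = d v" using same d[of v] by (auto simp: d0_def)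
        then show ?thesis using u uv by simp
      next
        case False
        then have v: "v \<notin> S" "c' v \<noteq> c v" "v \<notin> X" using S by auto
        then have "d v = c' v" "d0 v = c v" using d[of v] by (auto simp: d0_def)
        moreover have "e \<in> Q" if "c u \<noteq> c v"
          unfolding Q_def using that u uv v by (intro image_eqI[of _ _ "(u, v)"]) auto
        ultimately show ?thesis using u uv v by (cases "c u"; cases "c v"; cases "d u") auto
      qed
    qed
    have "cut_size S d - cut_size S c' = (\<Sum>e\<in>edges_at S. of_bool (is_cut d e) - of_bool (is_cut c' e))"
      by (simp add: cut_size_def sum_subtractf)
    also have "\<dots> \<le> (\<Sum>e\<in>edges_at S. of_bool (is_cut d0 e) - of_bool (is_cut c e) + 2 * of_bool (e \<in> Q))"
      using edge by (rule sum_mono)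
    also have "\<dots> = cut_size S d0 - cut_size S c + 2 * (\<Sum>e\<in>edges_at S. of_bool (e \<in> Q))"
      by (simp add: cut_size_def sum_subtractf sum.distrib sum_distrib_left)
    also have "(\<Sum>e\<in>edges_at S. of_bool (e \<in> Q) :: int) = int (card (edges_at S \<inter> Q))"
      using finS by (simp add: of_bool_def sum.If_cases)
    also have "\<dots> \<le> int (card Q)" using finQ by (simp add: card_mono)
    also have "cut_size S d0 \<le> cut_size S c"
      using assms(1) S unfolding stable_def d0_def by auto
    finally show ?thesis by simp
  qed
  define gain where "gain d = cut_size {v. d v \<noteq> c' v} d - cut_size {v. d v \<noteq> c' v} c'" for d
  have "\<exists>d. (finite {v. d v \<noteq> c' v} \<and> {v. d v \<noteq> c' v} \<subseteq> X) \<and>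
      (\<forall>d'. (finite {v. d' v \<noteq> c' v} \<and> {v. d' v \<noteq> c' v} \<subseteq> X) \<longrightarrow> gain d' \<le> gain d)"
    by (rule bounded_int_attains_max[of _ c' _ "2 * int (card Q)"]) (auto simp: gain_def intro!: bound)
  then obtain d where d: "finite {v. d v \<noteq> c' v}" "{v. d v \<noteq> c' v} \<subseteq> X"
    "\<And>d'. finite {v. d' v \<noteq> c' v} \<Longrightarrow> {v. d' v \<noteq> c' v} \<subseteq> X \<Longrightarrow> gain d' \<le> gain d" by blast
  \<comment> \<open>An improvement of the maximiser \<open>d\<close> would, measured on the common
    set \<open>T\<close>, have a larger gain over \<open>c'\<close>.\<close>
  have "stable X d"
    unfolding stable_def
  proof (intro allI impI)
    fix S d' assume S: "finite S \<and> S \<subseteq> X \<and> (\<forall>v. v \<notin> S \<longrightarrow> d' v = d v)"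
    define T where "T = S \<union> {v. d v \<noteq> c' v}"
    have T: "finite T" "T \<subseteq> F" "T \<subseteq> X" using S d assms by (auto simp: T_def)
    have sub: "{v. d' v \<noteq> c' v} \<subseteq> T" using S by (auto simp: T_def)
    have "gain d' \<le> gain d" by (rule d(3)) (use sub T finite_subset in auto)
    moreover have "gain d' = cut_size T d' - cut_size T c'"
      unfolding gain_def using sub T by (intro cut_size_diff_mono[symmetric]) auto
    moreover have "gain d = cut_size T d - cut_size T c'"
      unfolding gain_def using T by (intro cut_size_diff_mono[symmetric]) (auto simp: T_def)
    moreover have "cut_size T d' - cut_size T d = cut_size S d' - cut_size S d"
      using T S by (intro cut_size_diff_mono) (auto simp: T_def)
    ultimately show "cut_size S d' \<le> cut_size S d" by simp
  qed
  with d show ?thesis by blast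
qed

text \<open>Each part \<open>Y i\<close> needs only one finite repair for each of the finitely many colour patterns on its
  boundary in \<open>M\<close>. It therefore suffices to be stable on \<open>M\<close> together with the finite sets \<open>A i\<close>
  of vertices occurring in these repairs.\<close>
lemma glue_stable:
  assumes "countable X" "X \<subseteq> F" and X: "X = M \<union> (\<Union>i\<in>J. Y i)"
    and M: "\<And>i. i \<in> J \<Longrightarrow> M \<inter> Y i = {}"
    and disj: "\<And>i j. i \<in> J \<Longrightarrow> j \<in> J \<Longrightarrow> i \<noteq> j \<Longrightarrow> Y i \<inter> Y j = {}"
    and sep: "\<And>i j u v. i \<in> J \<Longrightarrow> j \<in> J \<Longrightarrow> i \<noteq> j \<Longrightarrow> u \<in> Y i \<Longrightarrow> v \<in> Y j \<Longrightarrow> \<not> E u v"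
    and bdry: "\<And>i. i \<in> J \<Longrightarrow> finite {v \<in> M. \<exists>u\<in>Y i. E u v}"
    and g: "\<And>i. i \<in> J \<Longrightarrow> stable (Y i) g"
  shows "\<exists>c. (\<forall>v. v \<notin> X \<longrightarrow> c v = g v) \<and> stable X c \<and> (\<forall>i\<in>J. finite {v \<in> Y i. c v \<noteq> g v})"
proof -
  define N where "N i = {v \<in> M. \<exists>u\<in>Y i. E u v}" for i
  \<comment> \<open>The boundary pattern in which exactly the vertices of \<open>P\<close> deviate
    from \<open>g\<close>.\<close>
  define gP where "gP P v = (if v \<in> P then \<not> g v else g v)" for P v
  have YF: "Y i \<subseteq> F" if "i \<in> J" for i using that X assms(2) by blast
  have repair: "\<exists>h. finite {v. h v \<noteq> gP P v} \<and> {v. h v \<noteq> gP P v} \<subseteq> Y i \<and> stable (Y i) h"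
    if i: "i \<in> J" and P: "P \<subseteq> N i" for i P
  proof (rule finite_repair[OF g[OF i] YF[OF i]])
    show "gP P v = g v" if "v \<in> Y i" for v
      using that P M[OF i] by (auto simp: gP_def N_def)
    have "N i \<subseteq> F" using X assms(2) by (auto simp: N_def)
    then have "finite (\<Union>v\<in>N i. {u. E v u})" using bdry[OF i] finite_degree unfolding N_def by blast
    then have "finite ((\<Union>v\<in>N i. {u. E v u}) \<times> N i)" using bdry[OF i] unfolding N_def by blast
    then show "finite {(u, v). u \<in> Y i \<and> v \<notin> Y i \<and> E u v \<and> gP P v \<noteq> g v \<and> g u \<noteq> g v}"
      by (rule finite_subset[rotated]) (use P sym in \<open>auto simp: gP_def\<close>)
  qed
  define h where "h i P = (SOME h. finite {v. h v \<noteq> gP P v} \<and> {v. h v \<noteq> gP P v} \<subseteq> Y i \<and> stable (Y i) h)"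
    for i P
  have h: "\<And>i P. i \<in> J \<Longrightarrow> P \<subseteq> N i \<Longrightarrow> finite {v. h i P v \<noteq> gP P v}"
    "\<And>i P. i \<in> J \<Longrightarrow> P \<subseteq> N i \<Longrightarrow> {v. h i P v \<noteq> gP P v} \<subseteq> Y i"
    "\<And>i P. i \<in> J \<Longrightarrow> P \<subseteq> N i \<Longrightarrow> stable (Y i) (h i P)"
    using someI_ex[OF repair] unfolding h_def by blast+
  define A where "A i = (\<Union>P\<in>Pow (N i). {v. h i P v \<noteq> gP P v})" for i
  have finA: "finite (A i)" and AY: "A i \<subseteq> Y i" if "i \<in> J" for i
  proof -
    have "finite (Pow (N i))" using bdry[OF that] by (simp add: N_def)
    then show "finite (A i)" unfolding A_def using h(1)[OF that] by blast
    show "A i \<subseteq> Y i" unfolding A_def using h(2)[OF that] by blast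
  qed
  define X' where "X' = M \<union> (\<Union>i\<in>J. A i)"
  have X'X: "X' \<subseteq> X" unfolding X'_def X using AY by blast
  obtain c where c: "\<And>v. v \<notin> X' \<Longrightarrow> c v = g v" "stable X' c"
    using exists_stable[of X' g] countable_subset[OF X'X assms(1)] subset_trans[OF X'X assms(2)] by blast
  have cA: "c v = g v" if "i \<in> J" "v \<in> Y i" "v \<notin> A i" for i v
  proof (rule c(1))
    have "v \<notin> A j" if "j \<in> J" for j
      using that \<open>i \<in> J\<close> \<open>v \<in> Y i\<close> \<open>v \<notin> A i\<close> AY[of j] disj[of i j] by blast
    then show "v \<notin> X'" using that M[of i] by (auto simp: X'_def)
  qed
  have hg: "h i P v = g v" if "i \<in> J" "P \<subseteq> N i" "v \<in> Y i" "v \<notin> A i" for i P v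
  proof -
    have "h i P v = gP P v" using that by (auto simp: A_def)
    moreover have "v \<notin> P" using that M[of i] by (auto simp: N_def)
    ultimately show ?thesis by (simp add: gP_def)
  qed
  have "stable X c"
    unfolding stable_def
  proof (intro allI impI)
    fix S d assume S: "finite S \<and> S \<subseteq> X \<and> (\<forall>v. v \<notin> S \<longrightarrow> d v = c v)"
    define J' where "J' = {i\<in>J. S \<inter> Y i \<noteq> {}}"
    have finJ': "finite J'"
    proof (rule ccontr)
      assume inf: "infinite J'"
      have "\<forall>i\<in>J'. \<exists>v. v \<in> S \<inter> Y i" by (auto simp: J'_def)
      then obtain f where f: "\<And>i. i \<in> J' \<Longrightarrow> f i \<in> S \<inter> Y i" by metis
      have "inj_on f J'"
      proof (rule inj_onI)
        fix i j assume "i \<in> J'" "j \<in> J'" "f i = f j"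
        then show "i = j" using f[of i] f[of j] disj[of i j] by (auto simp: J'_def)
      qed
      moreover have "finite (f ` J')" using f S by (meson IntD1 finite_subset image_subsetI)
      ultimately show False using inf finite_imageD by blast
    qed
    have J'J: "J' \<subseteq> J" by (auto simp: J'_def)
    define P where "P i = {v \<in> N i. d v \<noteq> g v}" for i
    have PN: "P i \<subseteq> N i" for i by (auto simp: P_def)
    define idx where "idx v = (THE i. i \<in> J' \<and> v \<in> Y i)" for v
    have idx: "idx v = i" if "i \<in> J'" "v \<in> Y i" for i v
    proof -
      have "j = i" if "j \<in> J'" "v \<in> Y j" for j
      proof (rule ccontr)
        assume "j \<noteq> i"
        then have "Y j \<inter> Y i = {}"
          using \<open>i \<in> J'\<close> \<open>j \<in> J'\<close> J'J by (intro disj) auto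
        then show False using \<open>v \<in> Y i\<close> \<open>v \<in> Y j\<close> by auto
      qed
      then show ?thesis unfolding idx_def using that by blast
    qed
    define U where "U = (\<Union>i\<in>J'. Y i)"
    \<comment> \<open>On the parts met by \<open>S\<close>, the competitor \<open>d\<close> is
      replaced by the prepared repair for the pattern \<open>P i\<close> that \<open>d\<close>
      itself shows on the boundary. This does not lower the cut, as \<open>d'\<close> is stable on
      these parts; and then only vertices of \<open>X'\<close>, where \<open>c\<close> is stable,
      differ from \<open>c\<close>.\<close>
    define d' where "d' v = (if v \<in> U then h (idx v) (P (idx v)) v else d v)" for v
    have d'Y: "d' v = h i (P i) v" if "i \<in> J'" "v \<in> Y i" for i v
      using that idx[OF that] by (auto simp: d'_def U_def)
    have UX: "U \<subseteq> F" using YF J'J by (auto simp: U_def)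
    define T where "T = S \<union> (\<Union>i\<in>J'. A i)"
    have "A i \<subseteq> F" "finite (A i)" if "i \<in> J'" for i
      using that AY[of i] YF[of i] finA[of i] J'J by auto
    then have T: "finite T" "T \<subseteq> F"
      using S finJ' assms(2) by (auto simp: T_def)
    have "stable U d'"
      unfolding U_def
    proof (rule stable_UN[OF finJ'])
      fix i assume i: "i \<in> J'"
      then have iJ: "i \<in> J" using J'J by blast
      show "Y i \<subseteq> F" using YF[OF iJ] .
      show "stable (Y i) d'"
      proof (rule stable_cong[OF h(3)[OF iJ PN[of i]]])
        show "h i (P i) v = d' v" if "v \<in> Y i" for v using d'Y[OF i that] by simp
        fix u v assume uv: "u \<in> Y i" "E u v"
        show "h i (P i) v = d' v"
        proof (cases "v \<in> Y i")
          case True then show ?thesis using d'Y[OF i] by simp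
        next
          case False
          have nY: "v \<notin> Y j" if "j \<in> J" for j
            using that False sep[OF iJ that _ uv(1)] uv(2) by blast
          have "d' v = d v" using nY J'J by (auto simp: d'_def U_def)
          moreover have "h i (P i) v = gP (P i) v" using h(2)[OF iJ PN[of i]] False by blast
          moreover have "gP (P i) v = d v"
          proof (cases "v \<in> M")
            case True
            then have "v \<in> N i" using uv by (auto simp: N_def)
            then show ?thesis by (auto simp: gP_def P_def)
          next
            case False
            then have nX: "v \<notin> X" using nY X by blast
            then have "v \<notin> S" "v \<notin> X'" using S X'X by (meson subsetD)+
            then have "d v = g v" using S c(1) by simp
            moreover have "v \<notin> P i" using False by (auto simp: P_def N_def)
            ultimately show ?thesis by (simp add: gP_def)
          qed
          ultimately show ?thesis by simp
        qed
      qed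
    next
      fix i j assume ij: "i \<in> J'" "j \<in> J'" "i \<noteq> j"
      then have ij': "i \<in> J" "j \<in> J" using J'J by auto
      show "Y i \<inter> Y j = {}" using disj[OF ij' ij(3)] .
      show "\<not> E u v" if "u \<in> Y i" "v \<in> Y j" for u v using sep[OF ij' ij(3) that] .
    qed
    moreover have "{v. d v \<noteq> d' v} \<subseteq> T \<inter> U"
    proof
      fix v assume v: "v \<in> {v. d v \<noteq> d' v}"
      then have vU: "v \<in> U" by (auto simp: d'_def split: if_splits)
      then obtain i where i: "i \<in> J'" "v \<in> Y i" by (auto simp: U_def)
      have "v \<in> T"
      proof (rule ccontr)
        assume "v \<notin> T"
        then have "v \<notin> S" "v \<notin> A i" using i by (auto simp: T_def)
        then have "d v = g v" using S cA[of i v] i J'J by auto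
        moreover have "d' v = g v" using d'Y[OF i] hg[of i "P i" v] i J'J PN \<open>v \<notin> A i\<close> by auto
        ultimately show False using v by simp
      qed
      with vU show "v \<in> T \<inter> U" by simp
    qed
    ultimately have le1: "cut_size T d \<le> cut_size T d'"
      using UX T stable_le by blast
    have "{v. d' v \<noteq> c v} \<subseteq> T \<inter> X'"
    proof
      fix v assume v: "v \<in> {v. d' v \<noteq> c v}"
      show "v \<in> T \<inter> X'"
      proof (cases "v \<in> U")
        case True
        then obtain i where i: "i \<in> J'" "v \<in> Y i" by (auto simp: U_def)
        have "v \<in> A i"
        proof (rule ccontr)
          assume nA: "v \<notin> A i"
          then have "d' v = g v" using d'Y[OF i] hg[of i "P i" v] i J'J PN by auto
          then show False using v cA[of i v] i J'J nA by auto
        qed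
        then show ?thesis using i J'J by (auto simp: T_def X'_def)
      next
        case False
        then have "d v \<noteq> c v" using v by (simp add: d'_def)
        then have vS: "v \<in> S" using S by blast
        have "v \<notin> Y i" if "i \<in> J" for i using False vS that by (auto simp: U_def J'_def)
        then have "v \<in> M" using vS S X by blast
        with vS show ?thesis by (auto simp: T_def X'_def)
      qed
    qed
    then have le2: "cut_size T d' \<le> cut_size T c"
      by (rule stable_le[OF c(2) subset_trans[OF X'X assms(2)] T])
    have "cut_size T d - cut_size T c = cut_size S d - cut_size S c"
      using S T by (intro cut_size_diff_mono) (auto simp: T_def)
    then show "cut_size S d \<le> cut_size S c" using le1 le2 by simp
  qed
  moreover have "finite {v \<in> Y i. c v \<noteq> g v}" if "i \<in> J" for i
    by (rule finite_subset[OF _ finA[OF that]]) (use cA[OF that] in auto)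
  moreover have "c v = g v" if "v \<notin> X" for v using that c(1) X'X by (meson subsetD)
  ultimately show ?thesis by (intro exI[of _ c]) simp
qed

end

subsection \<open>Normal spanning trees\<close>

locale countable_graph =
  fixes H :: "'a \<Rightarrow> 'a \<Rightarrow> bool" and V :: "'a set"
  assumes H_sym: "H u v \<Longrightarrow> H v u"
    and H_in: "H u v \<Longrightarrow> u \<in> V"
    and V_countable: "countable V"
begin

definition avoid :: "'a list \<Rightarrow> ('a \<times> 'a) set" where
  "avoid p = {(a, b). H a b \<and> a \<notin> set p \<and> b \<notin> set p}"

text \<open>For \<open>v\<close> off the path this is its component after deletion of
  \<open>p\<close>; for \<open>v\<close> on the path it degenerates to \<open>{v}\<close>.\<close>

definition comp :: "'a list \<Rightarrow> 'a \<Rightarrow> 'a set" where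
  "comp p v = {x. (v, x) \<in> (avoid p)\<^sup>*}"

definition target :: "'a set \<Rightarrow> 'a" where
  "target D = (ARG_MIN (to_nat_on V) x. x \<in> D)"

definition dist_avoid :: "'a list \<Rightarrow> 'a \<Rightarrow> 'a \<Rightarrow> nat" where
  "dist_avoid p x t = (LEAST n. (x, t) \<in> avoid p ^^ n)"

text \<open>The empty path imposes no adjacency, so each component of \<open>H\<close> gets a root
  of its own.\<close>

definition candidate :: "'a list \<Rightarrow> 'a set \<Rightarrow> 'a \<Rightarrow> bool" where
  "candidate p D x \<longleftrightarrow> x \<in> D \<and> (p = [] \<or> H (hd p) x)"

text \<open>Paths have their newest vertex first. The next vertex is adjacent to it, so that the branches
  of the tree are rays; it is closest to the target, the least vertex of the component in the
  enumeration, so that every vertex is reached after finitely many steps.\<close>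
definition next_vertex :: "'a list \<Rightarrow> 'a set \<Rightarrow> 'a" where
  "next_vertex p D = (ARG_MIN (\<lambda>x. dist_avoid p x (target D)) x. candidate p D x)"

primrec path_to :: "'a \<Rightarrow> nat \<Rightarrow> 'a list" where
  "path_to v 0 = []"
| "path_to v (Suc n) = (if v \<in> set (path_to v n) then path_to v n
     else next_vertex (path_to v n) (comp (path_to v n) v) # path_to v n)"

text \<open>The tree is present only through these lists, which lead from \<open>v\<close> down to
  the root of its component: \<open>u \<in> set (tree_path v)\<close> is the tree order.\<close>

definition tree_path :: "'a \<Rightarrow> 'a list" where
  "tree_path v = path_to v (LEAST n. v \<in> set (path_to v n))"

lemma avoid_antimono: "set p \<subseteq> set q \<Longrightarrow> avoid q \<subseteq> avoid p"
  by (auto simp: avoid_def)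

lemma avoid_rtrancl_antimono: "set p \<subseteq> set q \<Longrightarrow> (u, v) \<in> (avoid q)\<^sup>* \<Longrightarrow> (u, v) \<in> (avoid p)\<^sup>*"
  using rtrancl_mono[OF avoid_antimono] by blast

lemma avoid_rtrancl_sym: "(u, v) \<in> (avoid p)\<^sup>* \<Longrightarrow> (v, u) \<in> (avoid p)\<^sup>*"
proof -
  have "sym (avoid p)" using H_sym by (auto simp: avoid_def sym_def)
  then show "(u, v) \<in> (avoid p)\<^sup>* \<Longrightarrow> (v, u) \<in> (avoid p)\<^sup>*" using sym_rtrancl symD by metis
qed

lemma comp_eq: "(u, v) \<in> (avoid p)\<^sup>* \<Longrightarrow> comp p u = comp p v"
  unfolding comp_def by (meson Collect_cong avoid_rtrancl_sym rtrancl_trans)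

lemma comp_notin: "v \<notin> set p \<Longrightarrow> x \<in> comp p v \<Longrightarrow> x \<notin> set p"
  unfolding comp_def by (auto simp: avoid_def elim: rtranclE)

lemma comp_in: "v \<in> V \<Longrightarrow> x \<in> comp p v \<Longrightarrow> x \<in> V"
proof -
  assume v: "v \<in> V" and "x \<in> comp p v"
  then have "(v, x) \<in> (avoid p)\<^sup>*" by (simp add: comp_def)
  then show "x \<in> V"
    by (cases rule: rtranclE) (use v H_in H_sym in \<open>auto simp: avoid_def\<close>)
qed

lemma self_in_comp: "v \<in> comp p v"
  by (simp add: comp_def)

lemma comp_antimono: "set p \<subseteq> set q \<Longrightarrow> comp q v \<subseteq> comp p v"
  unfolding comp_def using avoid_rtrancl_antimono[of p q v] by (auto simp: subset_iff)

lemma target_in: "x \<in> D \<Longrightarrow> target D \<in> D"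
  and target_le: "x \<in> D \<Longrightarrow> to_nat_on V (target D) \<le> to_nat_on V x"
  unfolding target_def using arg_min_nat_lemma[of "\<lambda>x. x \<in> D" x "to_nat_on V"] by auto

text \<open>The walk is cut at its first arrival at \<open>r\<close>; the vertex before that is
  \<open>x\<close>.\<close>

lemma last_before_avoid:
  assumes "(v, r) \<in> (avoid p)\<^sup>*" "v \<noteq> r"
  shows "\<exists>x. (v, x) \<in> (avoid (r # p))\<^sup>* \<and> H x r"
  using assms
proof (induction rule: converse_rtrancl_induct)
  case base then show ?case by simp
next
  case (step v w)
  have vw: "H v w" "v \<notin> set p" "w \<notin> set p" using step.hyps(1) by (auto simp: avoid_def)
  show ?case
  proof (cases "w = r")
    case True
    then show ?thesis using vw by blast
  next
    case False
    then obtain x where x: "(w, x) \<in> (avoid (r # p))\<^sup>*" "H x r" using step.IH by blast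
    have "(v, w) \<in> avoid (r # p)" using vw False step.prems by (auto simp: avoid_def)
    then show ?thesis using x by (meson converse_rtrancl_into_rtrancl)
  qed
qed

text \<open>A walk of length \<open>m\<close> through \<open>r\<close> would contain a walk from
  \<open>r\<close> to \<open>t\<close> of length at most \<open>m\<close>.\<close>

lemma shortest_avoid:
  assumes "(x, t) \<in> avoid p ^^ m" "t \<noteq> r" "\<And>j. j \<le> m \<Longrightarrow> (r, t) \<notin> avoid p ^^ j"
  shows "(x, t) \<in> avoid (r # p) ^^ m"
  using assms
proof (induction m arbitrary: x)
  case 0 then show ?case by simp
next
  case (Suc m)
  obtain y where y: "(x, y) \<in> avoid p" "(y, t) \<in> avoid p ^^ m"
    using Suc.prems(1) by (meson relpow_Suc_D2)
  have "x \<noteq> r" using Suc.prems(1) Suc.prems(3)[of "Suc m"] by auto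
  moreover have "y \<noteq> r" using y(2) Suc.prems(3)[of m] by auto
  ultimately have "(x, y) \<in> avoid (r # p)" using y(1) by (auto simp: avoid_def)
  moreover have "(y, t) \<in> avoid (r # p) ^^ m"
    using Suc.IH[OF y(2)] Suc.prems(2,3) by simp
  ultimately show ?case by (meson relpow_Suc_I2)
qed

lemma next_vertex_candidate: "candidate p D x \<Longrightarrow> candidate p D (next_vertex p D)"
  and next_vertex_le: "candidate p D x \<Longrightarrow>
    dist_avoid p (next_vertex p D) (target D) \<le> dist_avoid p x (target D)"
  unfolding next_vertex_def
  using arg_min_nat_lemma[of "candidate p D" x "\<lambda>x. dist_avoid p x (target D)"] by auto

text \<open>When a new vertex is put on the path, take a walk to it from \<open>v\<close>: its last
  vertex before the arrival stays in the component of \<open>v\<close> and is adjacent to the new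
  head.\<close>

lemma candidate_exists: "v \<notin> set (path_to v n) \<Longrightarrow> \<exists>x. candidate (path_to v n) (comp (path_to v n) v) x"
proof (induction n)
  case 0
  then show ?case using self_in_comp by (auto simp: candidate_def)
next
  case (Suc n)
  let ?p = "path_to v n"
  let ?r = "next_vertex ?p (comp ?p v)"
  have v: "v \<notin> set ?p" "path_to v (Suc n) = ?r # ?p" "v \<noteq> ?r"
    using Suc.prems by (auto split: if_splits)
  have "candidate ?p (comp ?p v) ?r" using Suc.IH[OF v(1)] next_vertex_candidate by blast
  then have "(v, ?r) \<in> (avoid ?p)\<^sup>*" by (simp add: candidate_def comp_def)
  then obtain x where "(v, x) \<in> (avoid (?r # ?p))\<^sup>*" "H x ?r" using last_before_avoid v(3) by blast
  then show ?case unfolding v(2) unfolding candidate_def comp_def list.sel(1) using H_sym by blast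
qed

lemma next_vertex_path:
  assumes "v \<notin> set (path_to v n)"
  shows "candidate (path_to v n) (comp (path_to v n) v) (next_vertex (path_to v n) (comp (path_to v n) v))"
  using candidate_exists[OF assms] next_vertex_candidate by blast

lemma path_to_extends: "m \<le> n \<Longrightarrow> \<exists>xs. path_to v n = xs @ path_to v m"
proof (induction n)
  case 0 then show ?case by simp
next
  case (Suc n)
  show ?case
  proof (cases "m = Suc n")
    case True then show ?thesis by simp
  next
    case False
    then obtain xs where xs: "path_to v n = xs @ path_to v m" using Suc by auto
    then have "\<exists>ys. path_to v (Suc n) = ys @ path_to v n" by simp
    then show ?thesis using xs by (metis append.assoc)
  qed
qed

lemma path_to_set_mono: "m \<le> n \<Longrightarrow> set (path_to v m) \<subseteq> set (path_to v n)"
  using path_to_extends[of m n v] by auto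

text \<open>Otherwise the components shrink, so the indices of their targets grow, bounded by the
  index of \<open>v\<close>; the target is eventually constant. From then on its distance from the
  newest vertex falls at every step.\<close>

lemma path_to_reaches: "\<exists>n. v \<in> set (path_to v n)"
proof (rule ccontr)
  assume "\<not> ?thesis"
  then have never: "v \<notin> set (path_to v n)" for n by blast
  define p where "p n = path_to v n" for n
  define D where "D n = comp (p n) v" for n
  define r where "r n = next_vertex (p n) (D n)" for n
  define t where "t n = target (D n)" for n
  define k where "k n = dist_avoid (p n) (r n) (t n)" for n
  have p_Suc: "p (Suc n) = r n # p n" for n using never by (simp add: p_def r_def D_def)
  have vD: "v \<in> D n" for n by (simp add: D_def self_in_comp)
  have tD: "t n \<in> D n" for n unfolding t_def using target_in[OF vD] .
  have anti: "D n \<subseteq> D m" if "m \<le> n" for m n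
    unfolding D_def p_def using that by (intro comp_antimono path_to_set_mono)
  have tmono: "to_nat_on V (t m) \<le> to_nat_on V (t n)" if "m \<le> n" for m n
    unfolding t_def[of m] using anti[OF that] tD by (intro target_le) blast
  obtain N where N: "\<And>n. to_nat_on V (t n) \<le> to_nat_on V (t N)"
    using ex_has_greatest_nat[of "\<lambda>_. True" 0 "\<lambda>n. to_nat_on V (t n)" "Suc (to_nat_on V v)"]
      target_le[OF vD] unfolding t_def by (auto simp: less_Suc_eq_le)
  have t_eq: "t n = t N" if "N \<le> n" for n
  proof -
    have "t m \<in> V" for m
    proof (cases "v \<in> V")
      case True
      then show ?thesis using comp_in tD by (auto simp: D_def)
    next
      \<comment> \<open>A vertex outside \<open>V\<close> is isolated, so it would be reached in the
        first step.\<close>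
      case False
      have "comp [] v \<subseteq> {v}"
      proof
        fix x assume "x \<in> comp [] v"
        then have "(v, x) \<in> (avoid [])\<^sup>*" by (simp add: comp_def)
        then show "x \<in> {v}"
          by (cases rule: converse_rtranclE) (use False H_in in \<open>simp_all add: avoid_def\<close>)
      qed
      moreover have "r 0 \<in> comp [] v"
        using next_vertex_path[OF never, of 0] by (simp add: r_def p_def D_def candidate_def)
      ultimately have "r 0 = v" by blast
      then show ?thesis using never[of 1] by (simp add: r_def p_def D_def)
    qed
    moreover have "to_nat_on V (t n) = to_nat_on V (t N)" using N tmono[OF that] by (simp add: le_antisym)
    ultimately show ?thesis using V_countable by (simp add: to_nat_on_inj)
  qed
  have decr: "k (Suc n) < k n" if n: "N \<le> n" for n
  proof -
    have cand: "candidate (p n) (D n) (r n)"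
      unfolding p_def D_def r_def using next_vertex_path[OF never] by (simp add: p_def)
    then have "r n \<in> D n" by (simp add: candidate_def)
    moreover have "comp (p n) v = comp (p n) (r n)"
      using calculation unfolding D_def by (intro comp_eq) (simp add: comp_def)
    ultimately have "(r n, t n) \<in> (avoid (p n))\<^sup>*" using tD[of n] by (simp add: D_def comp_def)
    then have "\<exists>m. (r n, t n) \<in> avoid (p n) ^^ m" by (rule rtrancl_imp_relpow)
    then have kn: "(r n, t n) \<in> avoid (p n) ^^ k n"
      unfolding k_def dist_avoid_def by (rule LeastI_ex)
    have least: "(r n, t n) \<notin> avoid (p n) ^^ j" if "j < k n" for j
      using that not_less_Least unfolding k_def dist_avoid_def by blast
    have tS: "t (Suc n) = t n" using t_eq n by (metis le_Suc_eq)
    have tS': "t n \<notin> set (p (Suc n))"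
      using comp_notin[OF never[of "Suc n"]] tD[of "Suc n"] tS by (simp add: D_def p_def)
    then have rt: "t n \<noteq> r n" by (auto simp: p_Suc)
    then obtain m where m: "k n = Suc m" using kn by (cases "k n") auto
    \<comment> \<open>The second vertex of a shortest walk from \<open>r n\<close> to the target.
      The rest of the walk avoids \<open>r n\<close>, so \<open>x\<close> is a candidate in the next
      step and closer by one.\<close>
    obtain x where x: "(r n, x) \<in> avoid (p n)" "(x, t n) \<in> avoid (p n) ^^ m"
      using kn unfolding m by (meson relpow_Suc_D2)
    have xt: "(x, t n) \<in> avoid (p (Suc n)) ^^ m"
      unfolding p_Suc using x(2) rt least m by (intro shortest_avoid) auto
    then have "(x, t n) \<in> (avoid (p (Suc n)))\<^sup>*" by (rule relpow_imp_rtrancl)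
    then have "comp (p (Suc n)) x = comp (p (Suc n)) (t n)" by (rule comp_eq)
    moreover have "comp (p (Suc n)) v = comp (p (Suc n)) (t n)"
      using tD[of "Suc n"] tS by (intro comp_eq) (simp add: D_def comp_def)
    ultimately have "x \<in> D (Suc n)" using self_in_comp[of x "p (Suc n)"] by (simp add: D_def)
    then have "candidate (p (Suc n)) (D (Suc n)) x"
      using x(1) by (simp add: candidate_def p_Suc avoid_def)
    then have "k (Suc n) \<le> dist_avoid (p (Suc n)) x (t (Suc n))"
      unfolding k_def r_def t_def by (rule next_vertex_le)
    also have "\<dots> \<le> m"
      unfolding tS dist_avoid_def using xt by (rule Least_le)
    finally show ?thesis using m by simp
  qed
  have "k (N + i) + i \<le> k N" for i
  proof (induction i)
    case (Suc i)
    then show ?case using decr[of "N + i"] by simp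
  qed simp
  from this[of "Suc (k N)"] show False by simp
qed

section \<open>The tree order: ancestors, normality and rays\<close>

lemma tree_path_cases:
  obtains m where "v \<notin> set (path_to v m)" "tree_path v = path_to v (Suc m)"
    "tree_path v = v # path_to v m"
proof -
  define n where "n = (LEAST n. v \<in> set (path_to v n))"
  have n: "v \<in> set (path_to v n)" unfolding n_def using path_to_reaches by (rule LeastI_ex)
  then obtain m where m: "n = Suc m" by (cases n) auto
  have "v \<notin> set (path_to v m)" using not_less_Least[of m "\<lambda>n. v \<in> set (path_to v n)"] m n_def by auto
  moreover have "tree_path v = path_to v (Suc m)" using m n_def by (simp add: tree_path_def)
  ultimately show thesis using that[of m] n m by (auto split: if_splits)
qed

lemma tree_path_eqI:
  assumes "v \<notin> set (path_to v m)" "v \<in> set (path_to v (Suc m))"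
  shows "tree_path v = path_to v (Suc m)"
proof -
  have "(LEAST n. v \<in> set (path_to v n)) = Suc m"
  proof (rule Least_equality)
    show "Suc m \<le> n" if "v \<in> set (path_to v n)" for n
      using that assms(1) path_to_set_mono[of n m v] by (meson not_less_eq_eq subsetD)
  qed (rule assms(2))
  then show ?thesis by (simp add: tree_path_def)
qed

text \<open>Each step depends on the vertex aimed at only through its component. Since
  \<open>u\<close> and \<open>v\<close> are joined off \<open>path_to v k\<close>, even the vertex
  chosen after it is the same, hence the bound \<open>Suc k\<close>.\<close>

lemma path_to_agree:
  assumes "u \<notin> set (path_to v k)" "v \<notin> set (path_to v k)" "(v, u) \<in> (avoid (path_to v k))\<^sup>*" "j \<le> Suc k"
  shows "path_to u j = path_to v j"
  using assms(4)
proof (induction j)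
  case (Suc j)
  let ?p = "path_to v j"
  have eq: "path_to u j = ?p" using Suc by simp
  have sub: "set ?p \<subseteq> set (path_to v k)" using Suc.prems by (intro path_to_set_mono) simp
  have "comp ?p v = comp ?p u" by (rule comp_eq[OF avoid_rtrancl_antimono[OF sub assms(3)]])
  moreover have "u \<notin> set ?p" "v \<notin> set ?p" using assms sub by auto
  ultimately show ?case using eq by simp
qed simp

text \<open>Just before \<open>u\<close> enters the path towards \<open>v\<close>, both lie in one
  component, so the path towards \<open>u\<close> is the same up to that step and stops
  there.\<close>

lemma tree_path_ancestor:
  assumes "u \<in> set (tree_path v)"
  shows "\<exists>xs. tree_path v = xs @ tree_path u"
proof -
  obtain m where m: "v \<notin> set (path_to v m)" "tree_path v = path_to v (Suc m)"
    using tree_path_cases by metis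
  have um: "u \<in> set (path_to v (Suc m))" using assms by (simp only: m(2))
  define n where "n = (LEAST n. u \<in> set (path_to v n))"
  have n: "u \<in> set (path_to v n)" unfolding n_def using um by (rule LeastI)
  have nm: "n \<le> Suc m" unfolding n_def using um by (rule Least_le)
  obtain k where k: "n = Suc k" using n by (cases n) auto
  have uk: "u \<notin> set (path_to v k)"
    using not_less_Least[of k "\<lambda>n. u \<in> set (path_to v n)"] k n_def by auto
  have vk: "v \<notin> set (path_to v k)" using m(1) nm k path_to_set_mono[of k m v] by auto
  have u: "u = next_vertex (path_to v k) (comp (path_to v k) v)" using n uk vk k by simp
  then have "(v, u) \<in> (avoid (path_to v k))\<^sup>*"
    using next_vertex_path[OF vk] by (simp add: candidate_def comp_def)
  then have "path_to u j = path_to v j" if "j \<le> Suc k" for j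
    using path_to_agree[OF uk vk] that by blast
  from this[of k] this[of "Suc k"] have eq: "path_to u k = path_to v k" "path_to u (Suc k) = path_to v n"
    unfolding k by (simp_all del: path_to.simps)
  have "tree_path u = path_to v n" using tree_path_eqI[of u k] uk n unfolding eq by blast
  then show ?thesis using path_to_extends[OF nm, of v] unfolding m(2) by simp
qed

declare path_to.simps(2) [simp del]

text \<open>Normality of the tree. If \<open>u\<close> is not met before \<open>v\<close>, the edge
  joins them off the path built so far, so both paths agree until \<open>v\<close> has
  entered.\<close>

lemma tree_path_adjacent:
  assumes "H u v"
  shows "u \<in> set (tree_path v) \<or> v \<in> set (tree_path u)"
proof -
  obtain m where m: "v \<notin> set (path_to v m)" "tree_path v = path_to v (Suc m)"
    "tree_path v = v # path_to v m"
    using tree_path_cases by metis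
  show ?thesis
  proof (cases "u \<in> set (path_to v m)")
    case True then show ?thesis unfolding m(3) by simp
  next
    case False
    have "(v, u) \<in> avoid (path_to v m)" using False m(1) H_sym[OF assms] by (simp add: avoid_def)
    then have "(v, u) \<in> (avoid (path_to v m))\<^sup>*" by (rule r_into_rtrancl)
    then have eq: "path_to u j = path_to v j" if "j \<le> Suc m" for j
      using path_to_agree[OF False m(1)] that by blast
    obtain k where k: "tree_path u = path_to u (Suc k)" "tree_path u = u # path_to u k"
      using tree_path_cases by metis
    have "\<not> Suc k \<le> m"
    proof
      assume "Suc k \<le> m"
      then have "u \<in> set (path_to u m)"
        using k path_to_set_mono[of "Suc k" m u] by (metis list.set_intros(1) subsetD)
      then show False using eq[of m] False by simp
    qed
    then have "set (path_to u (Suc m)) \<subseteq> set (tree_path u)" unfolding k(1) by (intro path_to_set_mono) simp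
    moreover have "v \<in> set (path_to u (Suc m))" using eq[of "Suc m"] m by (metis list.set_intros(1) order_refl)
    ultimately show ?thesis by blast
  qed
qed

lemma path_to_walk:
  assumes "v \<in> V"
  shows "distinct (path_to v n) \<and> set (path_to v n) \<subseteq> V \<and> successively H (path_to v n)"
proof (induction n)
  case (Suc n)
  show ?case
  proof (cases "v \<in> set (path_to v n)")
    case False
    have "candidate (path_to v n) (comp (path_to v n) v) (next_vertex (path_to v n) (comp (path_to v n) v))"
      using next_vertex_path[OF False] .
    then show ?thesis
      using Suc False comp_notin[OF False] comp_in[OF assms] H_sym
      by (auto simp: candidate_def successively_Cons path_to.simps(2))
  qed (use Suc in \<open>simp add: path_to.simps(2)\<close>)
qed simp

lemma tree_path_walk:
  assumes "v \<in> V"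
  shows "distinct (tree_path v)" "set (tree_path v) \<subseteq> V" "successively H (tree_path v)"
  using path_to_walk[OF assms] by (auto simp: tree_path_def)

lemma self_in_tree_path: "v \<in> set (tree_path v)"
  using tree_path_cases[of v] by (metis list.set_intros(1))

lemma tree_path_neq_Nil: "tree_path v \<noteq> []" and hd_tree_path: "hd (tree_path v) = v"
  using tree_path_cases[of v] by (metis list.distinct(1), metis list.sel(1))

text \<open>The reversed tree paths of the \<open>y i\<close> properly prolong each other, and their
  limit is the ray.\<close>

lemma tree_chain_ray:
  assumes "\<And>i. y i \<in> V" and chain: "\<And>i. y i \<in> set (tree_path (y (Suc i)))" "\<And>i. y i \<noteq> y (Suc i)"
  shows "\<exists>r. inj r \<and> (\<forall>n. r n \<in> V) \<and> (\<forall>n. H (r n) (r (Suc n))) \<and> infinite {n. r n \<in> range y}"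
proof -
  define L where "L i = rev (tree_path (y i))" for i
  have L: "distinct (L i)" "set (L i) \<subseteq> V" "successively H (L i)" "L i \<noteq> []" "last (L i) = y i" for i
  proof -
    have "successively (\<lambda>x y. H y x) (tree_path (y i))"
      using tree_path_walk(3)[OF assms(1)] by (rule successively_mono) (rule H_sym)
    then show "successively H (L i)" by (simp add: L_def)
  qed (use tree_path_walk[OF assms(1)] tree_path_neq_Nil hd_tree_path in \<open>auto simp: L_def last_rev\<close>)
  have step: "\<exists>zs. zs \<noteq> [] \<and> L (Suc i) = L i @ zs" for i
  proof -
    obtain xs where "tree_path (y (Suc i)) = xs @ tree_path (y i)"
      using tree_path_ancestor[OF chain(1)] by blast
    then have "L (Suc i) = L i @ rev xs" by (simp add: L_def)
    moreover have "rev xs \<noteq> []" using calculation L(5)[of i] L(5)[of "Suc i"] chain(2)[of i] by auto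
    ultimately show ?thesis by blast
  qed
  have len: "i < length (L i)" for i
  proof (induction i)
    case 0 then show ?case using L(4)[of 0] by simp
  next
    case (Suc i)
    obtain zs where "zs \<noteq> []" "L (Suc i) = L i @ zs" using step by blast
    then show ?case using Suc by (cases zs) auto
  qed
  have ext: "\<exists>zs. L j = L i @ zs" if "i \<le> j" for i j
    using that
  proof (induction j)
    case (Suc j)
    show ?case
    proof (cases "i = Suc j")
      case False
      then show ?thesis using Suc step[of j] by (metis append.assoc le_Suc_eq)
    qed simp
  qed simp
  \<comment> \<open>\<open>L n\<close> has more than \<open>n\<close> entries, and every later
    \<open>L i\<close> has the same entry at position \<open>n\<close>.\<close>
  define r where "r n = L n ! n" for n
  have r: "L i ! n = r n" if "n \<le> i" for i n
  proof -
    from ext[OF that] obtain zs where "L i = L n @ zs" by blast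
    then show ?thesis using len[of n] by (simp add: r_def nth_append)
  qed
  have "H (r n) (r (Suc n))" for n
  proof -
    have "H (L (Suc n) ! n) (L (Suc n) ! Suc n)"
      using L(3)[of "Suc n"] len[of "Suc n"] by (auto simp: successively_conv_nth)
    then show ?thesis using r[of n "Suc n"] by (simp add: r_def)
  qed
  moreover have "r n \<in> V" for n
    using L(2)[of n] len[of n] nth_mem unfolding r_def by blast
  moreover have neq: "r n \<noteq> r m" if "n < m" for n m
    using nth_eq_iff_index_eq[OF L(1), of n m m] len[of m] that r[of n m] by (auto simp: r_def)
  then have "inj r" by (metis injI linorder_neqE_nat)
  moreover have "infinite {n. r n \<in> range y}"
  proof -
    have "\<exists>n\<ge>i. r n \<in> range y" for i
    proof -
      let ?n = "length (L i) - 1"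
      have n: "i \<le> ?n" using len[of i] by simp
      have "L ?n ! ?n = L i ! ?n"
      proof -
        obtain zs where "L ?n = L i @ zs" using ext[OF n] by blast
        moreover have "length (L i) - 1 < length (L i)" using L(4)[of i] by simp
        ultimately show ?thesis by (simp only: nth_append if_True)
      qed
      also have "\<dots> = y i" using L(4,5)[of i] by (simp add: last_conv_nth)
      finally show ?thesis using n by (auto simp: r_def)
    qed
    then show ?thesis by (auto simp: infinite_nat_iff_unbounded_le)
  qed
  ultimately show ?thesis by blast
qed

end

subsection \<open>Colouring along the tree\<close>

text \<open>\<open>E\<close> governs stability on \<open>F\<close>, whereas \<open>H\<close> governs
  the tree order and happiness on \<open>W\<close>. Edges of \<open>E\<close> inside
  \<open>W\<close> may be absent from \<open>H\<close>; vertices outside \<open>F \<union> W\<close>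
  will keep prescribed colours.\<close>

locale tree_colouring = cut_graph E F + countable_graph H "F \<union> W"
  for E :: "'a \<Rightarrow> 'a \<Rightarrow> bool" and F H W +
  assumes F_W_disjoint: "F \<inter> W = {}"
    and E_imp_H: "E u v \<Longrightarrow> u \<in> F \<Longrightarrow> v \<in> F \<union> W \<Longrightarrow> H u v"
    and W_infinite: "w \<in> W \<Longrightarrow> infinite {u. H w u}"
    and rays_leave_W: "inj r \<Longrightarrow> (\<And>n. r n \<in> F \<union> W) \<Longrightarrow> (\<And>n. H (r n) (r (Suc n))) \<Longrightarrow>
      finite {n. r n \<in> W}"
begin

definition up :: "'a \<Rightarrow> 'a set" where
  "up y = {v \<in> F \<union> W. y \<in> set (tree_path v)}"

text \<open>Asking for infinitely many opposite neighbours makes happiness of \<open>w\<close>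
  immune to finitely many changes at other vertices.\<close>

definition good :: "('a \<Rightarrow> bool) \<Rightarrow> 'a \<Rightarrow> bool" where
  "good c w \<longleftrightarrow> infinite {u. H w u \<and> c u \<noteq> c w}"

text \<open>\<open>g\<close> is the boundary colouring; the recursion needs solutions for every
  choice of it.\<close>

definition solves :: "('a \<Rightarrow> bool) \<Rightarrow> ('a \<Rightarrow> bool) \<Rightarrow> 'a set \<Rightarrow> bool" where
  "solves c g Z \<longleftrightarrow> (\<forall>v. v \<notin> Z \<longrightarrow> c v = g v) \<and> stable (F \<inter> Z) c \<and> (\<forall>w\<in>W \<inter> Z. good c w)"

lemma ancestor_trans:
  assumes "u \<in> set (tree_path v)" "v \<in> set (tree_path w)"
  shows "u \<in> set (tree_path w)"
  using tree_path_ancestor[OF assms(2)] assms(1) by auto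

lemma ancestor_length:
  assumes "u \<in> set (tree_path v)"
  shows "length (tree_path u) \<le> length (tree_path v)"
  using tree_path_ancestor[OF assms] by auto

lemma ancestor_eq:
  assumes "u \<in> set (tree_path v)" "length (tree_path v) \<le> length (tree_path u)"
  shows "u = v"
proof -
  obtain xs where "tree_path v = xs @ tree_path u" using tree_path_ancestor[OF assms(1)] by blast
  then have "tree_path v = tree_path u" using assms(2) by simp
  then show ?thesis using hd_tree_path by metis
qed

lemma ancestor_antisym: "u \<in> set (tree_path v) \<Longrightarrow> v \<in> set (tree_path u) \<Longrightarrow> u = v"
  using ancestor_eq ancestor_length by blast

lemma ancestor_linear:
  assumes "u \<in> set (tree_path v)" "u' \<in> set (tree_path v)"
  shows "u \<in> set (tree_path u') \<or> u' \<in> set (tree_path u)"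
proof -
  obtain xs ys where "tree_path v = xs @ tree_path u" "tree_path v = ys @ tree_path u'"
    using tree_path_ancestor assms by blast
  then obtain zs where "tree_path u = zs @ tree_path u' \<or> tree_path u' = zs @ tree_path u"
    by (metis append_eq_append_conv2)
  then show ?thesis using self_in_tree_path by (metis Un_iff set_append)
qed

lemma up_mono:
  assumes "u \<in> up v" shows "up u \<subseteq> up v"
proof
  fix x assume "x \<in> up u"
  then show "x \<in> up v" using assms ancestor_trans[of v u x] by (simp add: up_def)
qed

lemma up_step_H:
  assumes "u \<in> up y" "H u v"
  shows "v \<in> up y \<or> v \<in> set (tree_path u)"
  using tree_path_adjacent[OF assms(2)] ancestor_trans[of y u v] assms H_in[OF H_sym[OF assms(2)]]
  by (auto simp: up_def)

lemma good_cong: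
  assumes "good c w" "d w = c w" "finite A" "\<And>u. u \<notin> A \<Longrightarrow> H w u \<Longrightarrow> d u = c u"
  shows "good d w"
proof -
  have "{u. H w u \<and> c u \<noteq> c w} \<subseteq> A \<union> {u. H w u \<and> d u \<noteq> d w}" using assms(2,4) by auto
  then show ?thesis using assms(1,3) unfolding good_def by (meson finite_UnI finite_subset)
qed

text \<open>The subtrees above the minimal vertices \<open>Y\<close> of \<open>W \<inter> Z\<close>
  are disjoint and cover \<open>W \<inter> Z\<close>. Gluing their solutions changes finitely many
  colours in each, and by normality a vertex of \<open>W\<close> has only finitely many
  \<open>H\<close>-neighbours outside its subtree, so it stays good.\<close>

lemma solve_up_closed:
  assumes Z: "Z \<subseteq> F \<union> W" and up_closed: "\<And>v. v \<in> Z \<Longrightarrow> up v \<subseteq> Z"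
    and solvable: "\<And>y g. y \<in> W \<inter> Z \<Longrightarrow> \<exists>c. solves c g (up y)"
  shows "\<exists>c. solves c g Z"
proof -
  define Y where "Y = {y \<in> W \<inter> Z. \<forall>x\<in>set (tree_path y). x \<in> W \<inter> Z \<longrightarrow> x = y}"
  have Y_W: "y \<in> W" "y \<in> Z" "up y \<subseteq> Z" if "y \<in> Y" for y using that up_closed by (auto simp: Y_def)
  have covered: "\<exists>y\<in>Y. w \<in> up y" if w: "w \<in> W \<inter> Z" for w
  proof -
    let ?P = "\<lambda>x. x \<in> W \<inter> Z \<and> x \<in> set (tree_path w)"
    obtain x where x: "?P x" "\<And>x'. ?P x' \<Longrightarrow> length (tree_path x) \<le> length (tree_path x')"
      using ex_has_least_nat[of ?P w "\<lambda>x. length (tree_path x)"] w self_in_tree_path by blast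
    have "x' = x" if "x' \<in> set (tree_path x)" "x' \<in> W \<inter> Z" for x'
    proof (rule ancestor_eq[OF that(1)])
      show "length (tree_path x) \<le> length (tree_path x')"
        using that x ancestor_trans[of x' x w] by (intro x(2)) simp
    qed
    then have "x \<in> Y" using x(1) by (simp add: Y_def)
    moreover have "w \<in> up x" using x(1) w by (simp add: up_def)
    ultimately show ?thesis by blast
  qed
  have unique: "y = y'" if "y \<in> Y" "y' \<in> Y" "v \<in> up y" "v \<in> up y'" for y y' v
  proof -
    have "y \<in> set (tree_path y') \<or> y' \<in> set (tree_path y)"
      using that ancestor_linear[of y v y'] by (simp add: up_def)
    then show ?thesis using that(1,2) by (auto simp: Y_def)
  qed
  define cy where "cy y = (SOME c. solves c g (up y))" for y
  have cy: "solves (cy y) g (up y)" if "y \<in> Y" for y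
  proof -
    have "\<exists>c. solves c g (up y)" using Y_W(1,2)[OF that] by (intro solvable) simp
    then show ?thesis unfolding cy_def by (rule someI_ex)
  qed
  define root where "root v = (THE y. y \<in> Y \<and> v \<in> up y)" for v
  have root: "root v = y" if "y \<in> Y" "v \<in> up y" for v y
    unfolding root_def
  proof (rule the_equality)
    show "y' = y" if "y' \<in> Y \<and> v \<in> up y'" for y'
      using unique \<open>y \<in> Y\<close> \<open>v \<in> up y\<close> that by (meson unique)
  qed (use that in simp)
  define g0 where "g0 v = (if \<exists>y\<in>Y. v \<in> up y then cy (root v) v else g v)" for v
  have g0_in: "g0 v = cy y v" if "y \<in> Y" "v \<in> up y" for v y
  proof -
    have "\<exists>y\<in>Y. v \<in> up y" using that by blast
    then show ?thesis using root[OF that] by (simp add: g0_def)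
  qed
  have g0_out: "g0 v = g v" if "\<And>y. y \<in> Y \<Longrightarrow> v \<notin> up y" for v
    using that by (simp add: g0_def)
  have up_cross: "v \<in> up y \<or> v \<in> set (tree_path u)" if "u \<in> F \<inter> up y" "E u v" "v \<in> F \<union> W" for u v y
    using up_step_H[of u y v] E_imp_H that by blast
  have sep: "y = y'" if y: "y \<in> Y" "y' \<in> Y" and uv: "u \<in> F \<inter> up y" "v \<in> up y'" "E u v" for y y' u v
  proof -
    have v: "v \<in> F \<union> W" "y' \<in> set (tree_path v)" "u \<in> F \<union> W" using uv by (auto simp: up_def)
    from up_cross[OF uv(1,3) v(1)] show ?thesis
    proof
      assume "v \<in> up y" then show ?thesis using unique y uv by blast
    next
      assume "v \<in> set (tree_path u)"
      then have "u \<in> up y'" using v ancestor_trans[of y' v u] by (simp add: up_def)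
      then show ?thesis using unique y uv by blast
    qed
  qed
  let ?M = "F \<inter> Z - (\<Union>y\<in>Y. up y)"
  have "\<exists>c. (\<forall>v. v \<notin> F \<inter> Z \<longrightarrow> c v = g0 v) \<and> stable (F \<inter> Z) c \<and>
      (\<forall>y\<in>Y. finite {v \<in> F \<inter> up y. c v \<noteq> g0 v})"
  proof (rule glue_stable)
    show "countable (F \<inter> Z)" by (rule countable_subset[OF _ V_countable]) auto
    show "F \<inter> Z = ?M \<union> (\<Union>y\<in>Y. F \<inter> up y)" using Y_W(3) by blast
    show "(F \<inter> up y) \<inter> (F \<inter> up y') = {}" if "y \<in> Y" "y' \<in> Y" "y \<noteq> y'" for y y'
      using that unique[of y y'] by auto
    show "\<not> E u v" if "y \<in> Y" "y' \<in> Y" "y \<noteq> y'" "u \<in> F \<inter> up y" "v \<in> F \<inter> up y'" for y y' u v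
      using that sep[of y y' u v] by auto
    show "finite {v \<in> ?M. \<exists>u\<in>F \<inter> up y. E u v}" if y: "y \<in> Y" for y
    proof (rule finite_subset)
      \<comment> \<open>A boundary vertex lies below \<open>u\<close> in the tree, hence is
        comparable with \<open>y\<close>; not being in \<open>up y\<close>, it lies below
        \<open>y\<close>.\<close>
      show "{v \<in> ?M. \<exists>u\<in>F \<inter> up y. E u v} \<subseteq> set (tree_path y)"
      proof
        fix v assume "v \<in> {v \<in> ?M. \<exists>u\<in>F \<inter> up y. E u v}"
        then obtain u where v: "v \<in> F" "v \<notin> up y" and u: "u \<in> F \<inter> up y" "E u v" using y by blast
        then have "v \<in> set (tree_path u)" using up_cross[OF u] by blast
        moreover have "y \<in> set (tree_path u)" using u by (simp add: up_def)
        ultimately have "v \<in> set (tree_path y) \<or> y \<in> set (tree_path v)" by (rule ancestor_linear)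
        then show "v \<in> set (tree_path y)" using v by (auto simp: up_def)
      qed
    qed simp
    show "stable (F \<inter> up y) g0" if y: "y \<in> Y" for y
    proof (rule stable_cong)
      show "stable (F \<inter> up y) (cy y)" using cy[OF y] by (simp add: solves_def)
      show "cy y v = g0 v" if "v \<in> F \<inter> up y" for v using g0_in[OF y, of v] that by simp
      show "cy y v = g0 v" if uv: "u \<in> F \<inter> up y" "E u v" for u v
      proof (cases "v \<in> up y")
        case True then show ?thesis using g0_in[OF y] by simp
      next
        \<comment> \<open>By \<open>sep\<close> the neighbour lies in no other subtree either, so
          both colourings take the value of \<open>g\<close> there.\<close>
        case False
        then have "v \<notin> up y'" if "y' \<in> Y" for y' using sep[OF y that uv(1) _ uv(2)] by blast
        then show ?thesis using g0_out cy[OF y] False by (simp add: solves_def)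
      qed
    qed
  qed auto
  then obtain c where c: "\<And>v. v \<notin> F \<inter> Z \<Longrightarrow> c v = g0 v" "stable (F \<inter> Z) c"
    "\<And>y. y \<in> Y \<Longrightarrow> finite {v \<in> F \<inter> up y. c v \<noteq> g0 v}" by blast
  have goodc: "good c w" if w: "w \<in> W \<inter> Z" for w
  proof -
    obtain y where y: "y \<in> Y" "w \<in> up y" using covered[OF w] by blast
    show ?thesis
    proof (rule good_cong)
      show "good (cy y) w" using cy[OF y(1)] y(2) w by (simp add: solves_def)
      show "c w = cy y w" using c(1)[of w] w F_W_disjoint g0_in[OF y] by auto
      show "finite ({v \<in> F \<inter> up y. c v \<noteq> g0 v} \<union> set (tree_path w))" using c(3)[OF y(1)] by simp
      fix u assume u: "u \<notin> {v \<in> F \<inter> up y. c v \<noteq> g0 v} \<union> set (tree_path w)" "H w u"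
      then have "u \<in> up y" using up_step_H[OF y(2) u(2)] by blast
      then show "c u = cy y u" using u(1) c(1)[of u] g0_in[OF y(1), of u] by auto
    qed
  qed
  have "c v = g v" if v: "v \<notin> Z" for v
  proof -
    have "v \<notin> up y" if "y \<in> Y" for y using Y_W(3)[OF that] v by blast
    then show ?thesis using c(1)[of v] g0_out[of v] v by simp
  qed
  then show ?thesis using c(2) goodc unfolding solves_def by blast
qed

text \<open>Everything strictly above \<open>y\<close> is solved first, with \<open>y\<close>
  coloured by \<open>g\<close>. If \<open>y\<close> is then not good, switching it makes all but
  finitely many of its \<open>H\<close>-neighbours opposite and uncuts only finitely many edges into
  \<open>F \<inter> Z\<close>, so a finite repair suffices.\<close>

lemma solve_up:
  assumes y: "y \<in> W"
    and solvable: "\<And>x g. x \<in> W \<Longrightarrow> y \<in> set (tree_path x) \<Longrightarrow> x \<noteq> y \<Longrightarrow> \<exists>c. solves c g (up x)"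
  shows "\<exists>c. solves c g (up y)"
proof -
  define Z where "Z = up y - {y}"
  have "\<exists>c. solves c g Z"
  proof (rule solve_up_closed)
    show "Z \<subseteq> F \<union> W" by (auto simp: Z_def up_def)
    show "up v \<subseteq> Z" if "v \<in> Z" for v
      using that up_mono[of v y] ancestor_antisym[of v y] by (auto simp: Z_def up_def)
    show "\<exists>c. solves c h (up x)" if "x \<in> W \<inter> Z" for x h
      using that by (intro solvable) (auto simp: Z_def up_def)
  qed
  then obtain c where c: "\<And>v. v \<notin> Z \<Longrightarrow> c v = g v" "stable (F \<inter> Z) c" "\<And>w. w \<in> W \<inter> Z \<Longrightarrow> good c w"
    unfolding solves_def by blast
  have yup: "y \<in> up y" using y self_in_tree_path by (simp add: up_def)
  have yF: "y \<notin> F" using y F_W_disjoint by blast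
  have FZ: "F \<inter> Z = F \<inter> up y" using yF by (auto simp: Z_def)
  show ?thesis
  proof (cases "good c y")
    case True
    have "good c w" if "w \<in> W \<inter> up y" for w using c(3)[of w] True that by (auto simp: Z_def)
    moreover have "c v = g v" if "v \<notin> up y" for v using c(1)[of v] that by (simp add: Z_def)
    ultimately show ?thesis using c(2) unfolding solves_def FZ by blast
  next
    case False
    then have fin: "finite {u. H y u \<and> c u \<noteq> c y}" by (simp add: good_def)
    define c' where "c' = c(y := \<not> c y)"
    have "\<exists>d. finite {v. d v \<noteq> c' v} \<and> {v. d v \<noteq> c' v} \<subseteq> F \<inter> Z \<and> stable (F \<inter> Z) d"
    proof (rule finite_repair[OF c(2)])
      show "c' v = c v" if "v \<in> F \<inter> Z" for v using that by (auto simp: c'_def Z_def)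
      show "finite {(u, v). u \<in> F \<inter> Z \<and> v \<notin> F \<inter> Z \<and> E u v \<and> c' v \<noteq> c v \<and> c u \<noteq> c v}"
      proof (rule finite_subset)
        show "finite ({u. H y u \<and> c u \<noteq> c y} \<times> {y})" using fin by simp
        show "{(u, v). u \<in> F \<inter> Z \<and> v \<notin> F \<inter> Z \<and> E u v \<and> c' v \<noteq> c v \<and> c u \<noteq> c v}
          \<subseteq> {u. H y u \<and> c u \<noteq> c y} \<times> {y}"
          using y E_imp_H H_sym by (auto simp: c'_def split: if_splits)
      qed
    qed simp
    then obtain d where d: "finite {v. d v \<noteq> c' v}" "{v. d v \<noteq> c' v} \<subseteq> F \<inter> Z" "stable (F \<inter> Z) d"
      by blast
    have dW: "d w = c' w" if "w \<in> W" for w using that d(2) F_W_disjoint by blast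
    have "good d w" if w: "w \<in> W \<inter> Z" for w
    proof (rule good_cong[OF c(3)[OF w]])
      show "d w = c w" using dW[of w] w by (auto simp: c'_def Z_def)
      show "finite (insert y {v. d v \<noteq> c' v})" using d(1) by simp
    qed (auto simp: c'_def)
    moreover have "good d y"
    proof -
      have "{u. H y u} \<subseteq> insert y {v. d v \<noteq> c' v} \<union> {u. H y u \<and> c u \<noteq> c y} \<union> {u. H y u \<and> d u \<noteq> d y}"
        using dW[OF y] by (auto simp: c'_def)
      then show ?thesis
        using W_infinite[OF y] d(1) fin unfolding good_def by (meson finite_UnI finite_insert finite_subset)
    qed
    ultimately have "good d w" if "w \<in> W \<inter> up y" for w using that by (auto simp: Z_def)
    moreover have "d v = g v" if "v \<notin> up y" for v
    proof -
      have "d v = c' v" using that d(2) by (auto simp: Z_def)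
      then show ?thesis using that yup c(1)[of v] by (auto simp: c'_def Z_def)
    qed
    ultimately show ?thesis using d(3) unfolding solves_def FZ by blast
  qed
qed

text \<open>The recursion runs from the top of the tree downwards; an infinite ascending chain in
  \<open>W\<close> would yield an \<open>H\<close>-ray meeting \<open>W\<close> infinitely
  often.\<close>

lemma solve_all: "\<exists>c. solves c g (F \<union> W)"
proof (rule solve_up_closed)
  let ?R = "{(x, y). x \<in> W \<and> y \<in> W \<and> y \<in> set (tree_path x) \<and> x \<noteq> y}"
  have wf: "wf ?R"
    unfolding wf_iff_no_infinite_down_chain
  proof
    assume "\<exists>f. \<forall>i. (f (Suc i), f i) \<in> ?R"
    then obtain f where f: "\<And>i. (f (Suc i), f i) \<in> ?R" by blast
    have f_chain: "f i \<in> F \<union> W" "f i \<in> set (tree_path (f (Suc i)))" "f i \<noteq> f (Suc i)" for i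
      using f[of i] by auto
    obtain r where r: "inj r" "\<And>n. r n \<in> F \<union> W" "\<And>n. H (r n) (r (Suc n))" "infinite {n. r n \<in> range f}"
      using tree_chain_ray[where y = f, OF f_chain] by blast
    have "range f \<subseteq> W" using f by auto
    then have "{n. r n \<in> range f} \<subseteq> {n. r n \<in> W}" by blast
    then show False using r(4) rays_leave_W[OF r(1-3)] finite_subset by blast
  qed
  show "\<exists>c. solves c h (up y)" if "y \<in> W \<inter> (F \<union> W)" for y h
  proof -
    have "y \<in> W \<longrightarrow> (\<forall>h. \<exists>c. solves c h (up y))"
    proof (induction y rule: wf_induct_rule[OF wf])
      case (1 y)
      show ?case
      proof (intro impI allI)
        fix h assume y: "y \<in> W"
        show "\<exists>c. solves c h (up y)"
          by (rule solve_up[OF y]) (use 1 y in simp)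
      qed
    qed
    then show ?thesis using that by blast
  qed
qed (auto simp: up_def)

end

subsection \<open>Edges between vertices of infinite degree\<close>

text \<open>Decoding pairs gives an enumeration that visits every \<open>j\<close> infinitely often;
  each visit picks an element of \<open>A j\<close> not picked before.\<close>

lemma disjoint_refinement_countable:
  fixes A :: "'b \<Rightarrow> 'a set"
  assumes "countable J" and inf: "\<And>j. j \<in> J \<Longrightarrow> infinite (A j)"
  obtains R where "\<And>j. j \<in> J \<Longrightarrow> R j \<subseteq> A j" "\<And>j. j \<in> J \<Longrightarrow> infinite (R j)"
    "\<And>i j x. i \<in> J \<Longrightarrow> j \<in> J \<Longrightarrow> x \<in> R i \<Longrightarrow> x \<in> R j \<Longrightarrow> i = j"
proof (cases "J = {}")
  case True
  then show thesis using that[of A] by simp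
next
  case False
  let ?y = "\<lambda>n. from_nat_into J (fst (prod_decode n))"
  define pick where "pick = (\<lambda>f n. SOME x. x \<in> A (?y n) - f ` {..<n})"
  define s where "s = wfrec less_than (\<lambda>f n. pick f n)"
  have s_eq: "s n = pick s n" for n
  proof -
    have "s n = pick (cut s less_than n) n"
      unfolding s_def by (subst wfrec[OF wf_less_than]) simp
    also have "\<dots> = pick s n"
      unfolding pick_def by (simp add: cut_def image_def cong: conj_cong)
    finally show ?thesis .
  qed
  have s: "s n \<in> A (?y n) - s ` {..<n}" for n
  proof -
    have "infinite (A (?y n) - s ` {..<n})"
      using inf[OF from_nat_into[OF False]] by (simp add: Diff_infinite_finite)
    then have "\<exists>x. x \<in> A (?y n) - s ` {..<n}" using infinite_imp_nonempty by blast
    then show ?thesis unfolding s_eq[of n] pick_def by (rule someI_ex)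
  qed
  have "s m \<noteq> s n" if "m < n" for m n
    using s[of n] that by (metis DiffD2 imageI lessThan_iff)
  then have inj: "inj s" by (metis injI linorder_neqE_nat)
  show thesis
  proof (rule that[of "\<lambda>j. s ` {n. ?y n = j}"])
    fix j assume j: "j \<in> J"
    show "s ` {n. ?y n = j} \<subseteq> A j" using s by blast
    have "range (\<lambda>k. prod_encode (to_nat_on J j, k)) \<subseteq> {n. ?y n = j}"
      using j assms(1) by auto
    moreover have "inj (\<lambda>k. prod_encode (to_nat_on J j, k))" by (auto intro: injI)
    ultimately have "infinite {n. ?y n = j}" by (meson finite_subset infinite_UNIV_nat finite_imageD)
    then show "infinite (s ` {n. ?y n = j})" using inj by (meson finite_imageD inj_on_subset subset_UNIV)
  next
    fix i j x assume "x \<in> s ` {n. ?y n = i}" "x \<in> s ` {n. ?y n = j}"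
    then show "i = j" using injD[OF inj] by auto
  qed
qed

text \<open>Transfinite removal: a vertex goes once all but finitely many of its neighbours in
  \<open>I\<close> have gone. \<open>K\<close> is what survives, and \<open>r\<close> compares the
  stages of removal.\<close>

lemma perfect_kernel:
  fixes N :: "'a \<Rightarrow> 'a set"
  obtains K r where "K \<subseteq> I" "wf r" "\<And>y. y \<in> K \<Longrightarrow> infinite (N y \<inter> K)"
    "\<And>y. y \<in> I - K \<Longrightarrow> finite (N y \<inter> I - {u \<in> I - K. (u, y) \<in> r})"
proof -
  \<comment> \<open>Stages are indexed by sets of vertices, since this index type does not inject
    into \<open>'a\<close>.\<close>
  obtain ro :: "'a set rel" where ro: "well_order_on UNIV ro" using well_order_on by blast
  define R where "R = ro - Id"
  have wfR: "wf R" and totalR: "\<And>\<alpha> \<beta>. \<alpha> \<noteq> \<beta> \<Longrightarrow> (\<alpha>, \<beta>) \<in> R \<or> (\<beta>, \<alpha>) \<in> R" and transR: "trans R"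
    using ro unfolding R_def order_on_defs total_on_def by (auto simp: trans_diff_Id)
  define \<Phi> where "\<Phi> X = {y \<in> I. finite (N y \<inter> I - X)}" for X
  define S where "S = wfrec R (\<lambda>f \<alpha>. \<Phi> (\<Union>(f ` {\<beta>. (\<beta>, \<alpha>) \<in> R})))"
  define B where "B \<alpha> = \<Union>(S ` {\<beta>. (\<beta>, \<alpha>) \<in> R})" for \<alpha>
  have S: "S \<alpha> = \<Phi> (B \<alpha>)" for \<alpha>
  proof -
    have "S \<alpha> = \<Phi> (\<Union>(cut S R \<alpha> ` {\<beta>. (\<beta>, \<alpha>) \<in> R}))"
      unfolding S_def by (subst wfrec[OF wfR]) simp
    also have "cut S R \<alpha> ` {\<beta>. (\<beta>, \<alpha>) \<in> R} = S ` {\<beta>. (\<beta>, \<alpha>) \<in> R}"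
      by (rule image_cong) (simp_all add: cut_apply)
    finally show ?thesis by (simp add: B_def)
  qed
  have \<Phi>_mono: "\<Phi> X \<subseteq> \<Phi> Y" if "X \<subseteq> Y" for X Y
  proof
    fix y assume "y \<in> \<Phi> X"
    moreover have "N y \<inter> I - Y \<subseteq> N y \<inter> I - X" using that by blast
    ultimately show "y \<in> \<Phi> Y" unfolding \<Phi>_def using finite_subset by blast
  qed
  define A where "A = \<Union>(range S)"
  have A_I: "A \<subseteq> I" by (auto simp: A_def S \<Phi>_def)
  text \<open>The increasing stages cannot all be different, as there are more sets than elements.\<close>
  have "\<exists>\<alpha>. S \<alpha> \<subseteq> B \<alpha>"
  proof (rule ccontr)
    assume "\<not> ?thesis"
    then have "\<forall>\<alpha>. \<exists>x. x \<in> S \<alpha> - B \<alpha>" by blast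
    then obtain x where x: "\<And>\<alpha>. x \<alpha> \<in> S \<alpha> - B \<alpha>" by metis
    have "x \<alpha> \<noteq> x \<beta>" if "(\<beta>, \<alpha>) \<in> R" for \<alpha> \<beta> using x[of \<alpha>] x[of \<beta>] that by (auto simp: B_def)
    then have "inj x" using totalR by (metis injI)
    then have "surj (inv x)" by (rule inj_imp_surj_inv)
    then show False using Cantors_theorem[of "UNIV :: 'a set"] by auto
  qed
  then obtain \<alpha> where \<alpha>: "S \<alpha> \<subseteq> B \<alpha>" by blast
  \<comment> \<open>Once a stage adds nothing, no later one does; so the union \<open>A\<close> of
    all stages is closed under \<open>\<Phi>\<close>.\<close>
  have "S \<beta> \<subseteq> B \<alpha>" for \<beta>
  proof (induction \<beta> rule: wf_induct_rule[OF wfR])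
    case (1 \<beta>)
    have "B \<beta> \<subseteq> B \<alpha>" unfolding B_def[of \<beta>] by (rule UN_least, rule 1) simp
    then have "S \<beta> \<subseteq> S \<alpha>" unfolding S by (rule \<Phi>_mono)
    then show ?case using \<alpha> by blast
  qed
  then have "A \<subseteq> B \<alpha>" by (auto simp: A_def)
  then have "\<Phi> A \<subseteq> S \<alpha>" unfolding S by (rule \<Phi>_mono)
  then have closed: "\<Phi> A \<subseteq> A" by (auto simp: A_def)
  have "\<exists>\<alpha>. y \<in> S \<alpha> \<and> (\<forall>\<beta>. (\<beta>, \<alpha>) \<in> R \<longrightarrow> y \<notin> S \<beta>)" if "y \<in> A" for y
  proof -
    obtain \<beta> where "\<beta> \<in> {\<alpha>. y \<in> S \<alpha>}" using \<open>y \<in> A\<close> by (auto simp: A_def)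
    then show ?thesis by (rule wfE_min[OF wfR]) blast
  qed
  then obtain rank where rank: "\<And>y. y \<in> A \<Longrightarrow> y \<in> S (rank y)"
    "\<And>y \<beta>. y \<in> A \<Longrightarrow> (\<beta>, rank y) \<in> R \<Longrightarrow> y \<notin> S \<beta>" by metis
  show thesis
  proof (rule that[of "I - A" "inv_image R rank"])
    show "wf (inv_image R rank)" using wfR by simp
    show "infinite (N y \<inter> (I - A))" if "y \<in> I - A" for y
      using that closed by (auto simp: \<Phi>_def Int_Diff)
    fix y assume "y \<in> I - (I - A)"
    then have y: "y \<in> A" by blast
    have "u \<in> A \<and> (rank u, rank y) \<in> R" if u: "u \<in> B (rank y)" for u
    proof -
      obtain \<beta> where \<beta>: "(\<beta>, rank y) \<in> R" "u \<in> S \<beta>" using u by (auto simp: B_def)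
      then have uA: "u \<in> A" by (auto simp: A_def)
      have "(\<beta>, rank u) \<notin> R" using rank(2)[OF uA] \<beta>(2) by blast
      then have "rank u = \<beta> \<or> (rank u, \<beta>) \<in> R" using totalR by blast
      then show ?thesis using uA \<beta>(1) transD[OF transR] by blast
    qed
    then have "N y \<inter> I - {u \<in> I - (I - A). (u, y) \<in> inv_image R rank} \<subseteq> N y \<inter> I - B (rank y)"
      using A_I by auto
    moreover have "finite (N y \<inter> I - B (rank y))" using rank(1)[OF y] by (simp add: S \<Phi>_def)
    ultimately show "finite (N y \<inter> I - {u \<in> I - (I - A). (u, y) \<in> inv_image R rank})"
      by (rule finite_subset)
  qed blast
qed

text \<open>By disjointness every \<open>x\<close> has at most one parent, and \<open>rk\<close>
  falls towards it, so colours can alternate along parents by recursion. A vertex without parent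
  gets an arbitrary colour.\<close>

lemma exists_child_colouring:
  fixes rk :: "'a \<Rightarrow> nat"
  assumes disj: "\<And>i j x. i \<in> J \<Longrightarrow> j \<in> J \<Longrightarrow> x \<in> R i \<Longrightarrow> x \<in> R j \<Longrightarrow> i = j"
    and rk: "\<And>j x. j \<in> J \<Longrightarrow> x \<in> R j \<Longrightarrow> rk j < rk x"
  shows "\<exists>c :: 'a \<Rightarrow> bool. \<forall>j\<in>J. \<forall>x\<in>R j. c x \<noteq> c j"
proof -
  define parent where "parent x = (THE j. j \<in> J \<and> x \<in> R j)" for x
  have parent: "parent x = j" if "j \<in> J" "x \<in> R j" for j x
    unfolding parent_def using that disj by blast
  define c where "c = wfrec (measure rk) (\<lambda>f x. \<not> f (parent x))"
  have "c x \<noteq> c j" if "j \<in> J" "x \<in> R j" for j x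
  proof -
    have "c x = (\<not> cut c (measure rk) x (parent x))"
      unfolding c_def by (subst wfrec[OF wf_measure]) simp
    then show ?thesis using rk that by (simp add: parent[OF that] cut_apply)
  qed
  then show ?thesis by blast
qed

text \<open>Reduces unfriendliness at a vertex of infinite degree to having infinitely many opposite
  neighbours.\<close>

lemma lepoll_of_infinite:
  assumes "countable A" "infinite B"
  shows "A \<lesssim> B"
proof -
  have "A \<lesssim> (UNIV :: nat set)" using assms(1) unfolding countable_def lepoll_def by blast
  also have "\<dots> \<lesssim> B" using assms(2) infinite_le_lepoll by blast
  finally show ?thesis .
qed

section \<open>The graph \<open>H\<close> and the final partition\<close>

theorem theorem1:
  fixes V :: "'a set" and E :: "'a \<Rightarrow> 'a \<Rightarrow> bool"
  assumes "simple_graph V E"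
    and "countable V"
    and "\<not> (\<exists>r. alternating_ray V E r)"
  shows "\<exists>c :: 'a \<Rightarrow> bool. unfriendly_partition V E c"
proof -
  define N where "N = nbhd V E"
  define F where "F = {v \<in> V. finite (N v)}"
  define I where "I = {v \<in> V. infinite (N v)}"
  have E_sym: "E v u" and E_V: "u \<in> V" "v \<in> V" if "E u v" for u v
    using assms(1) that by (auto simp: simple_graph_def)
  have E_irrefl: "\<not> E v v" for v using assms(1) by (auto simp: simple_graph_def)
  have N: "N v = {u. E v u}" for v using E_V by (auto simp: N_def nbhd_def)
  have N_V: "N v \<subseteq> F \<union> I" for v using E_V by (auto simp: N F_def I_def)
  obtain K r where K: "K \<subseteq> I" and wf_r: "wf r" and K_inf: "\<And>y. y \<in> K \<Longrightarrow> infinite (N y \<inter> K)"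
    and lower: "\<And>y. y \<in> I - K \<Longrightarrow> finite (N y \<inter> I - {u \<in> I - K. (u, y) \<in> r})"
    by (rule perfect_kernel[of I N]) blast
  define W where "W = I - K"
  \<comment> \<open>The vertices that need a reserved set \<open>R y\<close>: those of
    \<open>K\<close>, for the first colouring, and those of \<open>W\<close> with too few neighbours
    in \<open>F\<close>.\<close>
  define J where "J = K \<union> {y \<in> W. finite (N y \<inter> F)}"
  let ?i = "to_nat_on V"
  define P where "P y = (if y \<in> K then N y \<inter> K else N y \<inter> {u \<in> W. (u, y) \<in> r})" for y
  have J_V: "J \<subseteq> V" using K by (auto simp: J_def W_def I_def)
  have P_inf: "infinite (P y)" if y: "y \<in> J" for y
  proof (cases "y \<in> K")
    case True then show ?thesis using K_inf by (simp add: P_def)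
  next
    case False
    then have yW: "y \<in> I - K" "finite (N y \<inter> F)" using y by (auto simp: J_def W_def)
    have "N y \<subseteq> (N y \<inter> F) \<union> (N y \<inter> I - {u \<in> I - K. (u, y) \<in> r}) \<union> P y"
      using N_V[of y] False by (auto simp: P_def W_def)
    moreover have "infinite (N y)" using yW by (simp add: I_def)
    ultimately show ?thesis using lower[OF yW(1)] yW(2) by (meson finite_UnI finite_subset)
  qed
  \<comment> \<open>Only finitely many vertices precede \<open>y\<close> in the enumeration of
    \<open>V\<close>. Letting indices increase from \<open>y\<close> to \<open>R y\<close> serves
    both the colouring \<open>c0\<close> and the exclusion of rays.\<close>
  have P_inf': "infinite {u \<in> P y. ?i y < ?i u}" if "y \<in> J" for y
  proof
    assume "finite {u \<in> P y. ?i y < ?i u}"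
    moreover have "finite {u \<in> V. ?i u \<le> ?i y}"
    proof (rule finite_imageD)
      show "finite (?i ` {u \<in> V. ?i u \<le> ?i y})" by (rule finite_subset[of _ "{..?i y}"]) auto
      show "inj_on ?i {u \<in> V. ?i u \<le> ?i y}"
        using inj_on_to_nat_on[OF assms(2)] by (rule inj_on_subset) auto
    qed
    moreover have "P y \<subseteq> {u \<in> P y. ?i y < ?i u} \<union> {u \<in> V. ?i u \<le> ?i y}"
      using E_V by (auto simp: P_def N split: if_splits)
    ultimately show False using P_inf[OF that] by (meson finite_UnI finite_subset)
  qed
  obtain R where R: "\<And>y. y \<in> J \<Longrightarrow> R y \<subseteq> {u \<in> P y. ?i y < ?i u}"
    and R_inf: "\<And>y. y \<in> J \<Longrightarrow> infinite (R y)"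
    and R_disj: "\<And>y y' x. y \<in> J \<Longrightarrow> y' \<in> J \<Longrightarrow> x \<in> R y \<Longrightarrow> x \<in> R y' \<Longrightarrow> y = y'"
    by (rule disjoint_refinement_countable[OF countable_subset[OF J_V assms(2)] P_inf']) blast+
  have R_W: "u \<in> W \<and> E y u \<and> (u, y) \<in> r \<and> ?i y < ?i u" if "y \<in> J" "y \<in> W" "u \<in> R y" for y u
    using R[OF that(1)] that by (auto simp: P_def N W_def)
  \<comment> \<open>For \<open>y \<in> K\<close> the set \<open>R y\<close> stays inside
    \<open>K\<close>, so \<open>c0\<close> already gives \<open>y\<close> infinitely many opposite
    neighbours there.\<close>
  have "\<exists>c0 :: 'a \<Rightarrow> bool. \<forall>y\<in>J. \<forall>u\<in>R y. c0 u \<noteq> c0 y"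
  proof (rule exists_child_colouring[of J R ?i])
    show "?i y < ?i u" if "y \<in> J" "u \<in> R y" for y u using R[OF that(1)] that(2) by blast
  qed (rule R_disj)
  then obtain c0 :: "'a \<Rightarrow> bool" where c0: "\<And>y u. y \<in> J \<Longrightarrow> u \<in> R y \<Longrightarrow> c0 u \<noteq> c0 y"
    by blast
  define H where "H u v \<longleftrightarrow> (E u v \<and> u \<in> F \<union> W \<and> v \<in> F \<union> W \<and> (u \<in> F \<or> v \<in> F))
    \<or> (u \<in> J \<inter> W \<and> v \<in> R u) \<or> (v \<in> J \<inter> W \<and> u \<in> R v)" for u v
  have H_E: "E u v" if "H u v" for u v using that R_W E_sym by (auto simp: H_def)
  have FW: "F \<inter> W = {}" by (auto simp: F_def W_def I_def)
  interpret tree_colouring E F H W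
  proof
    show "H u v \<Longrightarrow> H v u" for u v using E_sym by (auto simp: H_def)
    show "H u v \<Longrightarrow> u \<in> F \<union> W" for u v using R_W by (auto simp: H_def)
    show "countable (F \<union> W)"
      by (rule countable_subset[OF _ assms(2)]) (auto simp: F_def W_def I_def)
    show "finite {u. E v u}" if "v \<in> F" for v using that by (simp add: F_def N)
    show "infinite {u. H w u}" if w: "w \<in> W" for w
    proof (cases "finite (N w \<inter> F)")
      case True
      then have "w \<in> J" using w by (simp add: J_def)
      moreover have "R w \<subseteq> {u. H w u}" using w \<open>w \<in> J\<close> by (auto simp: H_def)
      ultimately show ?thesis using R_inf finite_subset by blast
    next
      case False
      moreover have "N w \<inter> F \<subseteq> {u. H w u}" using w by (auto simp: H_def N)
      ultimately show ?thesis using finite_subset by blast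
    qed
    show "finite {n. s n \<in> W}" if s: "inj s" "\<And>n. s n \<in> F \<union> W" "\<And>n. H (s n) (s (Suc n))" for s
    proof (rule ccontr)
      assume infW: "infinite {n. s n \<in> W}"
      have "is_ray V E s"
        unfolding is_ray_def using s(1) H_E[OF s(3)] E_V by blast
      moreover have "infinite {n. infinite (nbhd V E (s n))}"
        by (rule infinite_super[OF _ infW]) (auto simp: W_def I_def N_def)
      ultimately have "finite {n. finite (nbhd V E (s n))}"
        using assms(3) unfolding alternating_ray_def by blast
      then have "finite {n. s n \<in> F}" by (rule finite_subset[rotated]) (auto simp: F_def N_def)
      then obtain m where m: "\<And>n. s n \<in> F \<Longrightarrow> n < m" unfolding finite_nat_iff_bounded by auto
      have sW: "s n \<in> W \<and> s n \<notin> F" if "m \<le> n" for n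
        using m[of n] s(2)[of n] that by auto
      \<comment> \<open>On the tail inside \<open>W\<close>, a step into the reserved set of
        \<open>s n\<close> lowers the rank; otherwise the step leads from a reserved set back to its
        owner and lowers the index.\<close>
      let ?down = "\<lambda>n. s n \<in> J \<and> s (Suc n) \<in> R (s n)"
      have updown: "?down n \<or> (s (Suc n) \<in> J \<and> s n \<in> R (s (Suc n)))" if "m \<le> n" for n
        using s(3)[of n] sW[of n] sW[of "Suc n"] that by (auto simp: H_def)
      \<comment> \<open>A step back to an owner cannot follow a step down: by disjointness it would
        return to \<open>s n\<close>.\<close>
      have down_Suc: "?down (Suc n)" if "m \<le> n" "?down n" for n
      proof (rule ccontr)
        assume "\<not> ?down (Suc n)"
        then have "s (Suc (Suc n)) \<in> J" "s (Suc n) \<in> R (s (Suc (Suc n)))"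
          using updown[of "Suc n"] that(1) by auto
        then have "s n = s (Suc (Suc n))" using that(2) R_disj by blast
        then show False using injD[OF s(1)] by fastforce
      qed
      \<comment> \<open>So the tail of the ray descends forever in rank or forever in index.\<close>
      show False
      proof (cases "\<exists>n\<ge>m. ?down n")
        case True
        then obtain n where n: "m \<le> n" "?down n" by blast
        have down: "?down (n + k)" for k
        proof (induction k)
          case (Suc k) then show ?case using down_Suc[of "n + k"] n(1) by simp
        qed (use n in simp)
        have "(s (n + Suc k), s (n + k)) \<in> r" for k
          using R_W[of "s (n + k)" "s (Suc (n + k))"] down[of k] sW[of "n + k"] n(1) by simp
        then have "\<exists>f. \<forall>k. (f (Suc k), f k) \<in> r" by (intro exI[of _ "\<lambda>k. s (n + k)"]) blast
        then show False using wf_r unfolding wf_iff_no_infinite_down_chain by blast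
      next
        case False
        have less: "?i (s (Suc n)) < ?i (s n)" if "m \<le> n" for n
          using updown[OF that] False that R_W[of "s (Suc n)" "s n"] sW[of "Suc n"] by auto
        have "?i (s (m + k)) + k \<le> ?i (s m)" for k
        proof (induction k)
          case (Suc k) then show ?case using less[of "m + k"] by simp
        qed simp
        from this[of "Suc (?i (s m))"] show False by simp
      qed
    qed
  qed (use E_sym E_irrefl FW in \<open>auto simp: H_def\<close>)
  obtain c where c: "\<And>v. v \<notin> F \<union> W \<Longrightarrow> c v = c0 v" "stable F c" "\<And>w. w \<in> W \<Longrightarrow> good c w"
    using solve_all[of c0] by (auto simp: solves_def Int_absorb1 Int_absorb2)
  have "{u \<in> N v. c u = c v} \<lesssim> {u \<in> N v. c u \<noteq> c v}" if v: "v \<in> V" for v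
  proof (cases "v \<in> F")
    case True
    then have "finite (N v)" by (simp add: F_def)
    moreover have "card {u \<in> N v. c u = c v} \<le> card {u \<in> N v. c u \<noteq> c v}"
      using stable_friendly_le[OF c(2) True] by (simp add: N)
    ultimately show ?thesis by (simp add: lepoll_iff_card_le)
  next
    case False
    have "infinite {u \<in> N v. c u \<noteq> c v}"
    proof (cases "v \<in> W")
      case True
      then have "infinite {u. H v u \<and> c u \<noteq> c v}" using c(3) by (simp add: good_def)
      then show ?thesis by (rule infinite_super[rotated]) (auto simp: N H_E)
    next
      case False
      then have vK: "v \<in> K" "v \<in> J" using v \<open>v \<notin> F\<close> by (auto simp: F_def W_def I_def J_def)
      have c_K: "c u = c0 u" if "u \<in> K" for u
        using that K by (intro c(1)) (auto simp: F_def W_def I_def)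
      have "R v \<subseteq> {u \<in> N v. c u \<noteq> c v}"
      proof
        fix u assume u: "u \<in> R v"
        then have "u \<in> N v" "u \<in> K" using R[OF vK(2)] vK(1) by (auto simp: P_def)
        then show "u \<in> {u \<in> N v. c u \<noteq> c v}" using c_K vK c0[OF vK(2) u] by simp
      qed
      then show ?thesis using R_inf[OF vK(2)] finite_subset by blast
    qed
    moreover have "countable {u \<in> N v. c u = c v}"
      by (rule countable_subset[OF _ assms(2)]) (auto simp: N_def nbhd_def)
    ultimately show ?thesis by (intro lepoll_of_infinite)
  qed
  then show ?thesis unfolding unfriendly_partition_def N_def by blast
qed

end
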